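(* $\{h_k:k\geq2\}^\perp\cap\mathcal{D}_{\delta_1}=\{0\}$, where $\perp$ denotes the orthogonal complement in $H^2$. In particular, the only function holomorphic on a neighborhood of the closed unit disk $\overline{\mathbb{D}}$ that is orthogonal in $H^2$ to every $h_k$, $k\ge2$, is the zero function.
   Context: $H^2$ is the Hardy space on the open unit disk $\mathbb{D}$, $dA$ normalized area measure. For $k\geq 2$, $h_k(z)=\frac{1}{1-z}\big(\mathrm{Log}(1-z^k)-\mathrm{Log}(1-z)-\ln k\big)$ with $\mathrm{Log}$ the principal branch. The local Dirichlet space at $1$, $\mathcal{D}_{\delta_1}$, is the set of $f\in H^2$ with $\int_{\mathbb{D}}|f'(z)|^2\frac{1-|z|^2}{|z-1|^2}\,dA(z)<\infty$; equivalently, $f=c+(z-1)g$ for some $c\in\mathbb{C}$ and $g\in H^2$. *)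

theory Defs
  imports "HOL-Analysis.Analysis"
begin

definition tcoeff :: "(complex \<Rightarrow> complex) \<Rightarrow> nat \<Rightarrow> complex" where
  "tcoeff f n = (deriv ^^ n) f 0 / of_nat (fact n)"

definition H2 :: "(complex \<Rightarrow> complex) set" where
  "H2 = {f. f holomorphic_on ball 0 1 \<and> summable (\<lambda>n. (norm (tcoeff f n))\<^sup>2)}"

definition H2_inner :: "(complex \<Rightarrow> complex) \<Rightarrow> (complex \<Rightarrow> complex) \<Rightarrow> complex" where
  "H2_inner f g = (\<Sum>n. tcoeff f n * cnj (tcoeff g n))"

definition h :: "nat \<Rightarrow> complex \<Rightarrow> complex" where
  "h k z = (Ln (1 - z ^ k) - Ln (1 - z) - of_real (ln (real k))) / (1 - z)"

text \<open>Local Dirichlet space at 1 (dA = normalized area measure = Lebesgue measure / pi).\<close>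
definition local_dirichlet_1 :: "(complex \<Rightarrow> complex) set" where
  "local_dirichlet_1 = {f. f \<in> H2 \<and>
     (\<integral>\<^sup>+ z. ennreal (indicator (ball 0 1) z * (norm (deriv f z))\<^sup>2
                     * (1 - (norm z)\<^sup>2) / (norm (z - 1))\<^sup>2 / pi) \<partial>lborel) < \<infinity>}"

end

theory Submission
  imports Defs "HOL-Complex_Analysis.Complex_Analysis"
begin

text \<open>
  The Dirichlet integral at \<open>1\<close> is the integral of \<open>\<bar>f' / (1 - z)\<bar>\<^sup>2\<close> against the radial weight
  \<open>1 - \<bar>z\<bar>\<^sup>2\<close>. Monomials are orthogonal for such a weight, so finiteness of the integral bounds the
  coefficients of \<open>f' / (1 - z)\<close>, and Copson's inequality turns this into \<open>f = c + (z - 1) g\<close> with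
  \<open>g = \<Sum>n. b\<^bsub>n+1\<^esub> z\<^sup>n\<close> in \<open>H\<^sup>2\<close>. Summation by parts rewrites the orthogonality to \<open>h k\<close> as
  \<open>\<Sum>j\<ge>1. b\<^bsub>kj\<^esub> / j = A - c ln k\<close>, with \<open>A\<close> independent of \<open>k\<close>. The left-hand side tends to \<open>0\<close> as
  \<open>k \<rightarrow> \<infinity>\<close> because \<open>b \<in> \<ell>\<^sup>2\<close>; hence \<open>c = A = 0\<close>, all the sums \<open>\<Sum>j\<ge>1. b\<^bsub>kj\<^esub> / (kj)\<close> vanish, and
  a sieve gives \<open>b = 0\<close>.
\<close>

section \<open>Copson's inequality\<close>

text \<open>AM-GM dominates the terms by \<open>(x n)\<^sup>2 + 1 / (n + 1)\<^sup>2\<close>. This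
  makes the tails in Copson's inequality and the series of \<open>b n / n\<close> converge
  absolutely.\<close>

lemma summable_divide_of_square_summable:
  fixes x :: "nat \<Rightarrow> real"
  assumes "summable (\<lambda>n. (x n)\<^sup>2)"
  shows "summable (\<lambda>n. \<bar>x n\<bar> / (real n + 1))"
proof (rule summable_comparison_test')
  have "summable (\<lambda>n. inverse ((real (Suc n))\<^sup>2))"
    using inverse_power_summable[of 2, where 'a = real] by (subst summable_Suc_iff) auto
  then show "summable (\<lambda>n. (x n)\<^sup>2 + inverse ((real (Suc n))\<^sup>2))"
    using assms by (intro summable_add)
  fix n :: nat
  define y where "y = inverse (real (Suc n))"
  have "2 * \<bar>x n\<bar> * y \<le> (x n)\<^sup>2 + y\<^sup>2"
    using sum_squares_bound[of "\<bar>x n\<bar>" y] by simp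
  moreover have "0 \<le> \<bar>x n\<bar> * y" by (simp add: y_def)
  ultimately have "\<bar>x n\<bar> * y \<le> (x n)\<^sup>2 + y\<^sup>2" by linarith
  then show "norm (\<bar>x n\<bar> / (real n + 1)) \<le> (x n)\<^sup>2 + inverse ((real (Suc n))\<^sup>2)"
    by (simp add: y_def divide_inverse power_inverse add.commute)
qed

text \<open>This is the dual of Hardy's inequality. The tails \<open>u n\<close> satisfy
  \<open>u n - u (Suc n) = x n / (n + 1)\<close>, so summation by parts bounds the sum of
  \<open>(u n)\<^sup>2\<close> by a boundary term plus twice the sum of \<open>u n * x n\<close>;
  half of the left-hand side is then absorbed.\<close>

theorem copson_square_summable:
  fixes x :: "nat \<Rightarrow> real"
  assumes sq: "summable (\<lambda>n. (x n)\<^sup>2)" and nonneg: "\<And>n. 0 \<le> x n"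
  shows "summable (\<lambda>n. (\<Sum>m. x (m + n) / (real (m + n) + 1))\<^sup>2)"
proof -
  define u where "u n = (\<Sum>m. x (m + n) / (real (m + n) + 1))" for n
  define q where "q n = x n / (real n + 1)" for n
  define S where "S = (\<Sum>n. (x n)\<^sup>2)"
  have sumq: "summable q"
    using summable_divide_of_square_summable[OF sq] nonneg by (simp add: q_def[abs_def])
  have u_eq: "u n = (\<Sum>m. q (m + n))" for n
    by (simp add: u_def q_def)
  have q0: "0 \<le> q n" for n using nonneg by (simp add: q_def)
  have u_nonneg: "0 \<le> u n" for n
    unfolding u_eq using sumq q0 by (intro suminf_nonneg) (auto simp: summable_iff_shift)
  have u_Suc: "u n = q n + u (Suc n)" for n
    using suminf_split_head[of "\<lambda>m. q (m + n)"] sumq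
    by (simp add: u_eq summable_iff_shift)
  have Sle: "(\<Sum>n<N. (x n)\<^sup>2) \<le> S" for N
    unfolding S_def using sq by (intro sum_le_suminf) auto
  have S0: "0 \<le> S" using Sle[of 0] by simp
  text \<open>\<open>1/(m+1)\<^sup>2 \<le> 1/(m+1/2) - 1/(m+3/2)\<close> makes the sum telescope.\<close>
  have inv_sum: "(\<Sum>m<K. (1 / (real (m + N) + 1))\<^sup>2) \<le> 1 / (real N + 1/2) - 1 / (real (K + N) + 1/2)" for K N
  proof (induction K)
    case (Suc K)
    define y where "y = real (K + N) + 1"
    have y: "y \<ge> 1" by (simp add: y_def)
    have "1 / (y - 1/2) - 1 / (y + 1/2) = 1 / (y\<^sup>2 - 1/4)"
      using y by (simp add: field_simps power2_eq_square)
    moreover have "1 / y\<^sup>2 \<le> 1 / (y\<^sup>2 - 1/4)"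
    proof -
      have "1 \<le> y\<^sup>2" using y by (rule one_le_power)
      then show ?thesis by (intro divide_left_mono mult_pos_pos) auto
    qed
    ultimately have "(1 / y)\<^sup>2 \<le> 1 / (y - 1/2) - 1 / (y + 1/2)"
      by (simp add: power_divide)
    moreover have "real (K + N) + 1/2 = y - 1/2" "real (Suc K + N) + 1/2 = y + 1/2" "real (K + N) + 1 = y"
      by (simp_all add: y_def)
    ultimately show ?case
      using Suc.IH by (simp only: sum.lessThan_Suc)
  qed simp
  \<comment> \<open>Cauchy-Schwarz on the tail, with \<open>inv_sum\<close> for the weights. This
    controls the boundary term in \<open>step\<close>.\<close>
  have u_sq: "real N * (u N)\<^sup>2 \<le> S" for N
  proof -
    have "(\<lambda>K. (\<Sum>m<K. q (m + N))\<^sup>2) \<longlonglongrightarrow> (u N)\<^sup>2"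
      unfolding u_eq using sumq
      by (intro tendsto_power summable_LIMSEQ) (simp add: summable_iff_shift)
    moreover have "(\<Sum>m<K. q (m + N))\<^sup>2 \<le> S * (1 / (real N + 1/2))" for K
    proof -
      have "(\<Sum>m<K. q (m + N))\<^sup>2 = (\<Sum>m<K. x (m + N) * (1 / (real (m + N) + 1)))\<^sup>2"
        by (simp add: q_def)
      also have "\<dots> \<le> (\<Sum>m<K. (x (m + N))\<^sup>2) * (\<Sum>m<K. (1 / (real (m + N) + 1))\<^sup>2)"
        by (rule Cauchy_Schwarz_ineq_sum)
      also have "\<dots> \<le> S * (1 / (real N + 1/2))"
      proof (rule mult_mono)
        have "(\<Sum>m<K. (x (m + N))\<^sup>2) = (\<Sum>m\<in>(\<lambda>m. m + N) ` {..<K}. (x m)\<^sup>2)"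
          by (subst sum.reindex) (auto simp: inj_on_def)
        also have "\<dots> \<le> S"
          unfolding S_def using sq by (intro sum_le_suminf) auto
        finally show "(\<Sum>m<K. (x (m + N))\<^sup>2) \<le> S" .
        have "0 \<le> 1 / (real (K + N) + 1/2)" by simp
        then show "(\<Sum>m<K. (1 / (real (m + N) + 1))\<^sup>2) \<le> 1 / (real N + 1/2)"
          using inv_sum[of N K] by linarith
      qed (auto simp: S0 intro: sum_nonneg)
      finally show ?thesis .
    qed
    ultimately have "(u N)\<^sup>2 \<le> S * (1 / (real N + 1/2))"
      by (intro LIMSEQ_le_const2) auto
    then have "(real N + 1/2) * (u N)\<^sup>2 \<le> S"
      by (simp add: field_simps)
    then show ?thesis
      using zero_le_power2[of "u N"] unfolding distrib_right by linarith
  qed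
  \<comment> \<open>Discrete integration by parts. The inequality comes from dropping the square
    \<open>(real M + 1) * (u M - u (Suc M))\<^sup>2\<close>.\<close>
  have step: "(\<Sum>n<M. (u n)\<^sup>2) \<le> real M * (u M)\<^sup>2 + 2 * (\<Sum>n<M. u n * x n)" for M
  proof (induction M)
    case (Suc M)
    have x_eq: "x M = (real M + 1) * (u M - u (Suc M))"
      using u_Suc[of M] by (simp add: q_def field_simps)
    have "0 \<le> (real M + 1) * (u M - u (Suc M))\<^sup>2" by simp
    then have "(real M + 1) * (u M)\<^sup>2 \<le> (real M + 1) * (u (Suc M))\<^sup>2 + 2 * (u M * x M)"
      unfolding x_eq by (simp add: power2_eq_square algebra_simps)
    then show ?case
      using Suc.IH by (simp add: algebra_simps)
  qed simp
  \<comment> \<open>Weighted AM-GM, \<open>2 * u * x \<le> u\<^sup>2 / 2 + 2 * x\<^sup>2\<close>,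
    leaves half of the left-hand side to absorb. The boundary term contributes \<open>S\<close> and
    the rest \<open>2 * S\<close>; doubling gives \<open>6 * S\<close>.\<close>
  have "(\<Sum>n<M. (u n)\<^sup>2) \<le> 6 * S" for M
  proof -
    have "2 * (u n * x n) \<le> (u n)\<^sup>2 / 2 + 2 * (x n)\<^sup>2" for n
      using zero_le_power2[of "u n - 2 * x n"] by (simp add: power2_eq_square algebra_simps)
    then have "2 * (\<Sum>n<M. u n * x n) \<le> (\<Sum>n<M. (u n)\<^sup>2 / 2 + 2 * (x n)\<^sup>2)"
      unfolding sum_distrib_left by (intro sum_mono)
    also have "\<dots> = (\<Sum>n<M. (u n)\<^sup>2) / 2 + 2 * (\<Sum>n<M. (x n)\<^sup>2)"
      by (simp add: sum.distrib sum_divide_distrib sum_distrib_left)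
    finally show ?thesis
      using step[of M] u_sq[of M] Sle[of M] by linarith
  qed
  then have "summable (\<lambda>n. (u n)\<^sup>2)"
    by (intro summableI_nonneg_bounded) auto
  then show ?thesis by (simp add: u_def)
qed

section \<open>Sums over multiples\<close>

text \<open>Sieve of Eratosthenes: the sums over \<open>j\<close> without prime divisors below \<open>r\<close> all vanish, and as
  \<open>r\<close> grows only the term \<open>j = 1\<close> survives. Unlike Moebius inversion, this needs no more than
  absolute convergence.\<close>
lemma eq_0_if_sums_over_multiples_eq_0:
  fixes c :: "nat \<Rightarrow> complex"
  assumes summ: "summable (\<lambda>n. norm (c n))"
    and zero: "\<And>m. 0 < m \<Longrightarrow> (\<Sum>\<^sub>\<infinity>j\<in>{0<..}. c (m * j)) = 0"
    and "0 < m"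
  shows "c m = 0"
proof -
  have norm_on: "(\<lambda>n. norm (c n)) summable_on A" for A
    using summ by (intro summable_on_subset_banach[OF norm_summable_imp_summable_on, of "\<lambda>n. norm (c n)"]) auto
  have norm_on_mult: "(\<lambda>j. norm (c (m * j))) summable_on A" if "0 < m" for m A
    using norm_on[of "(*) m ` A"] that
    by (subst (asm) summable_on_reindex) (auto simp: inj_on_def o_def)
  have on_mult: "(\<lambda>j. c (m * j)) summable_on A" if "0 < m" for m A
    using norm_on_mult[OF that] by (rule abs_summable_summable)
  define P where "P r = {j::nat. 0 < j \<and> (\<forall>p. prime p \<longrightarrow> p < r \<longrightarrow> \<not> p dvd j)}" for r
  have sieve: "(\<Sum>\<^sub>\<infinity>j\<in>P r. c (m * j)) = 0" if "0 < m" for r m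
    using that
  proof (induction r arbitrary: m)
    case 0
    then show ?case using zero[of m] by (simp add: P_def greaterThan_def)
  next
    case (Suc r)
    show ?case
    proof (cases "prime r")
      case False
      then have "P (Suc r) = P r" by (auto simp: P_def less_Suc_eq)
      with Suc show ?thesis by simp
    next
      case True
      \<comment> \<open>Sieving out the prime \<open>r\<close> removes exactly the multiples
        \<open>r * i\<close> with \<open>i\<close> in \<open>P r\<close>. Their sum is the vanishing
        sum for \<open>m * r\<close> in place of \<open>m\<close>, which is why the induction leaves
        \<open>m\<close> arbitrary.\<close>
      have split: "P r = P (Suc r) \<union> (*) r ` P r"
      proof (intro equalityI subsetI)
        fix j assume j: "j \<in> P r"
        show "j \<in> P (Suc r) \<union> (*) r ` P r"
        proof (cases "r dvd j")
          case True
          then obtain i where "j = r * i" by blast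
          with j have "i \<in> P r" by (auto simp: P_def)
          with \<open>j = r * i\<close> show ?thesis by blast
        next
          case False
          with j show ?thesis by (auto simp: P_def less_Suc_eq)
        qed
      next
        fix j assume "j \<in> P (Suc r) \<union> (*) r ` P r"
        then show "j \<in> P r"
          using True by (auto simp: P_def prime_dvd_mult_iff prime_gt_0_nat dest: primes_dvd_imp_eq)
      qed
      have disj: "P (Suc r) \<inter> (*) r ` P r = {}"
        using True by (auto simp: P_def)
      have "0 = (\<Sum>\<^sub>\<infinity>j\<in>P (Suc r) \<union> (*) r ` P r. c (m * j))"
        using Suc.IH[OF Suc.prems] split by simp
      also have "\<dots> = (\<Sum>\<^sub>\<infinity>j\<in>P (Suc r). c (m * j)) + (\<Sum>\<^sub>\<infinity>j\<in>(*) r ` P r. c (m * j))"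
        using on_mult[OF Suc.prems] disj by (intro infsum_Un_disjoint)
      also have "(\<Sum>\<^sub>\<infinity>j\<in>(*) r ` P r. c (m * j)) = (\<Sum>\<^sub>\<infinity>j\<in>P r. c (m * r * j))"
        using True by (subst infsum_reindex) (auto simp: inj_on_def o_def mult.assoc prime_gt_0_nat)
      also have "\<dots> = 0"
        using Suc.IH[of "m * r"] Suc.prems True by (simp add: prime_gt_0_nat)
      finally show ?thesis by simp
    qed
  qed
  \<comment> \<open>Every \<open>j \<noteq> 1\<close> in \<open>P r\<close> has a prime factor at
    least \<open>r\<close>. Once \<open>j = 1\<close> is split off, only indices
    \<open>m * j \<ge> r\<close> remain, so a tail of the convergent series bounds
    \<open>c m\<close>.\<close>
  have bound: "norm (c m) \<le> (\<Sum>i. norm (c (i + r)))" if "0 < r" for r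
  proof -
    have one: "P r = insert 1 (P r - {1})"
      by (auto simp: P_def)
    have large: "r \<le> m * j" if "j \<in> P r - {1}" for j
    proof -
      have "j \<noteq> 1" "j > 0" using that by (auto simp: P_def)
      then obtain p where p: "prime p" "p dvd j" using prime_factor_nat by blast
      then have "r \<le> p" using that by (force simp: P_def not_less)
      also have "p \<le> j" using p \<open>j > 0\<close> by (intro dvd_imp_le)
      also have "j \<le> m * j" using \<open>0 < m\<close> by simp
      finally show ?thesis .
    qed
    have "0 = (\<Sum>\<^sub>\<infinity>j\<in>insert 1 (P r - {1}). c (m * j))"
      using sieve[OF \<open>0 < m\<close>, of r] one by simp
    also have "\<dots> = c m + (\<Sum>\<^sub>\<infinity>j\<in>P r - {1}. c (m * j))"
      using on_mult[OF \<open>0 < m\<close>] by (subst infsum_insert) auto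
    finally have "norm (c m) = norm (\<Sum>\<^sub>\<infinity>j\<in>P r - {1}. c (m * j))"
      by (metis add_eq_0_iff norm_minus_cancel)
    also have "\<dots> \<le> (\<Sum>\<^sub>\<infinity>j\<in>P r - {1}. norm (c (m * j)))"
      by (intro norm_infsum_bound norm_on_mult \<open>0 < m\<close>)
    also have "\<dots> = (\<Sum>\<^sub>\<infinity>n\<in>(*) m ` (P r - {1}). norm (c n))"
      using \<open>0 < m\<close> by (subst infsum_reindex) (auto simp: inj_on_def o_def)
    also have "\<dots> \<le> (\<Sum>\<^sub>\<infinity>n\<in>(\<lambda>i. i + r) ` UNIV. norm (c n))"
    proof (intro infsum_mono_neutral norm_on)
      fix n assume "n \<in> (*) m ` (P r - {1}) - range (\<lambda>i. i + r)"
      then have "r \<le> n" "n \<notin> range (\<lambda>i. i + r)" using large by auto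
      then have False by (metis le_add_diff_inverse2 rangeI)
      then show "norm (c n) \<le> 0" ..
    qed auto
    also have "\<dots> = (\<Sum>\<^sub>\<infinity>i. norm (c (i + r)))"
      by (subst infsum_reindex) (auto simp: inj_on_def o_def)
    also have "\<dots> = (\<Sum>i. norm (c (i + r)))"
      using summ summable_iff_shift[of "\<lambda>n. norm (c n)" r]
      by (intro infsumI norm_summable_imp_has_sum summable_sums) simp_all
    finally show ?thesis .
  qed
  have "norm (c m) \<le> 0"
  proof (rule field_le_epsilon)
    fix e :: real assume "0 < e"
    then obtain N where N: "\<And>n. n \<ge> N \<Longrightarrow> norm (\<Sum>i. norm (c (i + n))) < e"
      using suminf_exist_split[OF \<open>0 < e\<close> summ] by blast
    show "norm (c m) \<le> 0 + e"
      using bound[of "Suc N"] N[of "Suc N"] by auto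
  qed
  then show ?thesis by simp
qed

section \<open>Radially weighted Bergman norms\<close>

lemma lborel_complex_eq_distr:
  "(lborel :: complex measure) = distr (lborel \<Otimes>\<^sub>M lborel) borel (\<lambda>(x, y). Complex x y)"
proof (rule lborel_eqI)
  have meas: "(\<lambda>(x, y). Complex x y) \<in> borel_measurable (borel :: (real \<times> real) measure)"
    by (intro borel_measurable_continuous_onI)
      (auto simp: case_prod_beta Complex_eq intro!: continuous_intros)
  fix l u :: complex
  assume "\<And>b. b \<in> Basis \<Longrightarrow> l \<bullet> b \<le> u \<bullet> b"
  from this[of 1] this[of \<i>] have le: "Re l \<le> Re u" "Im l \<le> Im u"
    by (simp_all add: Basis_complex_def)
  have "emeasure (distr (lborel \<Otimes>\<^sub>M lborel) borel (\<lambda>(x, y). Complex x y)) (box l u)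
      = emeasure lborel ((\<lambda>(x, y). Complex x y) -` box l u)"
    using meas by (simp add: lborel_prod emeasure_distr)
  also have "(\<lambda>(x, y). Complex x y) -` box l u = box (Re l, Im l) (Re u, Im u)"
    by (auto simp: box_def Basis_complex_def Basis_prod_def)
  also have "emeasure lborel \<dots> = ennreal (\<Prod>b\<in>Basis. ((Re u, Im u) - (Re l, Im l)) \<bullet> b)"
    using le by (intro emeasure_lborel_box) (auto simp: Basis_prod_def)
  also have "(\<Prod>b\<in>Basis. ((Re u, Im u) - (Re l, Im l)) \<bullet> b) = (Re u - Re l) * (Im u - Im l)"
    by (simp add: Basis_prod_def prod.union_disjoint prod.reindex inj_on_def)
  also have "\<dots> = (\<Prod>b\<in>Basis. (u - l) \<bullet> b)"
    by (simp add: Basis_complex_def)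
  finally show "emeasure (distr (lborel \<Otimes>\<^sub>M lborel) borel (\<lambda>(x, y). Complex x y)) (box l u)
      = ennreal (\<Prod>b\<in>Basis. (u - l) \<bullet> b)" .
qed simp

lemma measurable_Complex [measurable (raw)]:
  assumes [measurable]: "f \<in> borel_measurable M" "g \<in> borel_measurable M"
  shows "(\<lambda>x. Complex (f x) (g x)) \<in> borel_measurable M"
  unfolding Complex_eq by measurable

text \<open>Both orders of integration are recorded because each kind of shear is, in the right
  order, a translation in the inner integral.\<close>

lemma nn_integral_lborel_complex:
  assumes [measurable]: "f \<in> borel_measurable borel"
  shows "(\<integral>\<^sup>+z. f z \<partial>lborel) = (\<integral>\<^sup>+y. \<integral>\<^sup>+x. f (Complex x y) \<partial>lborel \<partial>lborel)"
    and "(\<integral>\<^sup>+z. f z \<partial>lborel) = (\<integral>\<^sup>+x. \<integral>\<^sup>+y. f (Complex x y) \<partial>lborel \<partial>lborel)"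
proof -
  have "(\<integral>\<^sup>+z. f z \<partial>lborel) = (\<integral>\<^sup>+p. f (Complex (fst p) (snd p)) \<partial>(lborel \<Otimes>\<^sub>M lborel))"
    by (subst lborel_complex_eq_distr, subst nn_integral_distr) (auto simp: case_prod_beta)
  then show "(\<integral>\<^sup>+z. f z \<partial>lborel) = (\<integral>\<^sup>+y. \<integral>\<^sup>+x. f (Complex x y) \<partial>lborel \<partial>lborel)"
    and "(\<integral>\<^sup>+z. f z \<partial>lborel) = (\<integral>\<^sup>+x. \<integral>\<^sup>+y. f (Complex x y) \<partial>lborel \<partial>lborel)"
    using lborel_pair.nn_integral_snd[of "\<lambda>p. f (Complex (fst p) (snd p))"]
      lborel.nn_integral_fst[of "\<lambda>p. f (Complex (fst p) (snd p))" "lborel :: real measure"] by simp_all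
qed

lemma nn_integral_shear_Re:
  assumes [measurable]: "f \<in> borel_measurable borel"
  shows "(\<integral>\<^sup>+z. f (Complex (Re z + t * Im z) (Im z)) \<partial>lborel) = (\<integral>\<^sup>+z. f z \<partial>lborel)"
proof -
  have "(\<integral>\<^sup>+x. f (Complex (x + t * y) y) \<partial>lborel) = (\<integral>\<^sup>+x. f (Complex x y) \<partial>lborel)" for y
    using nn_integral_real_affine[of "\<lambda>x. f (Complex x y)" 1 "t * y"] by (simp add: add.commute)
  then show ?thesis
    by (simp add: nn_integral_lborel_complex(1))
qed

lemma nn_integral_shear_Im:
  assumes [measurable]: "f \<in> borel_measurable borel"
  shows "(\<integral>\<^sup>+z. f (Complex (Re z) (Im z + t * Re z)) \<partial>lborel) = (\<integral>\<^sup>+z. f z \<partial>lborel)"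
proof -
  have "(\<integral>\<^sup>+y. f (Complex x (y + t * x)) \<partial>lborel) = (\<integral>\<^sup>+y. f (Complex x y) \<partial>lborel)" for x
    using nn_integral_real_affine[of "\<lambda>y. f (Complex x y)" 1 "t * x"] by (simp add: add.commute)
  then show ?thesis
    by (simp add: nn_integral_lborel_complex(2))
qed

text \<open>A rotation by an angle other than \<open>\<pi>\<close> is a product of three shears.\<close>
lemma nn_integral_rotate:
  assumes [measurable]: "f \<in> borel_measurable borel" and "norm \<omega> = 1" "Re \<omega> \<noteq> -1"
  shows "(\<integral>\<^sup>+z. f (\<omega> * z) \<partial>lborel) = (\<integral>\<^sup>+z. f z \<partial>lborel)"
proof -
  \<comment> \<open>For \<open>\<omega> = cis \<theta>\<close> this is
    \<open>- tan (\<theta> / 2)\<close>, and \<open>s\<close> is \<open>sin \<theta>\<close>. The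
    rotation is a horizontal shear by \<open>t\<close>, a vertical shear by \<open>s\<close> and
    again a horizontal shear by \<open>t\<close>.\<close>
  define t where "t = - Im \<omega> / (1 + Re \<omega>)"
  define s where "s = Im \<omega>"
  have unit: "(Re \<omega>)\<^sup>2 + (Im \<omega>)\<^sup>2 = 1"
    using assms(2) by (simp add: cmod_def)
  have t: "t * (1 + Re \<omega>) = - s"
    using assms(3) by (simp add: t_def s_def)
  have "(s * t + 1 - Re \<omega>) * (1 + Re \<omega>) = s * (t * (1 + Re \<omega>)) + (1 - (Re \<omega>)\<^sup>2)"
    by (simp add: algebra_simps power2_eq_square)
  also have "\<dots> = 1 - (Re \<omega>)\<^sup>2 - s\<^sup>2"
    unfolding t by (simp add: power2_eq_square)
  finally have "(s * t + 1 - Re \<omega>) * (1 + Re \<omega>) = 1 - (Re \<omega>)\<^sup>2 - s\<^sup>2" .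
  moreover have "1 + Re \<omega> \<noteq> 0" using assms(3) by linarith
  moreover have "1 - (Re \<omega>)\<^sup>2 - s\<^sup>2 = 0" using unit by (simp add: s_def)
  ultimately have st: "s * t = Re \<omega> - 1" by simp
  define g where "g z = f (Complex (Re z + t * Im z) (Im z))" for z
  define k where "k z = g (Complex (Re z) (Im z + s * Re z))" for z
  have [measurable]: "g \<in> borel_measurable borel" "k \<in> borel_measurable borel"
    by (simp_all add: g_def[abs_def] k_def[abs_def])
  have "\<omega> * z = Complex (Re z + t * Im z + t * (Im z + s * (Re z + t * Im z)))
      (Im z + s * (Re z + t * Im z))" for z
  proof (rule complex_eqI)
    have "Re z + t * Im z + t * (Im z + s * (Re z + t * Im z))
        = (1 + s * t) * Re z + (t * (1 + (1 + s * t))) * Im z"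
      by (simp add: algebra_simps)
    also have "\<dots> = Re (\<omega> * z)" using st t by (simp add: s_def)
    finally show "Re (\<omega> * z) = Re (Complex (Re z + t * Im z + t * (Im z + s * (Re z + t * Im z)))
      (Im z + s * (Re z + t * Im z)))" by simp
    have "Im z + s * (Re z + t * Im z) = s * Re z + (1 + s * t) * Im z"
      by (simp add: algebra_simps)
    also have "\<dots> = Im (\<omega> * z)" using st by (simp add: s_def)
    finally show "Im (\<omega> * z) = Im (Complex (Re z + t * Im z + t * (Im z + s * (Re z + t * Im z)))
      (Im z + s * (Re z + t * Im z)))" by simp
  qed
  then have "f (\<omega> * z) = k (Complex (Re z + t * Im z) (Im z))" for z
    by (simp add: g_def k_def)
  then have "(\<integral>\<^sup>+z. f (\<omega> * z) \<partial>lborel) = (\<integral>\<^sup>+z. k z \<partial>lborel)"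
    by (simp add: nn_integral_shear_Re)
  also have "\<dots> = (\<integral>\<^sup>+z. g z \<partial>lborel)"
    unfolding k_def by (intro nn_integral_shear_Im) measurable
  also have "\<dots> = (\<integral>\<^sup>+z. f z \<partial>lborel)"
    unfolding g_def by (intro nn_integral_shear_Re) measurable
  finally show ?thesis .
qed

lemma distr_lborel_rotate:
  assumes "norm \<omega> = 1" "Re \<omega> \<noteq> -1"
  shows "distr lborel borel ((*) \<omega>) = (lborel :: complex measure)"
proof (rule measure_eqI)
  fix A assume "A \<in> sets (distr lborel borel ((*) \<omega>))"
  then have [measurable]: "A \<in> sets borel" by simp
  have "emeasure (distr lborel borel ((*) \<omega>)) A = (\<integral>\<^sup>+z. indicator A z \<partial>distr lborel borel ((*) \<omega>))"
    by simp
  also have "\<dots> = (\<integral>\<^sup>+z. indicator A (\<omega> * z) \<partial>lborel)"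
    by (intro nn_integral_distr) auto
  also have "\<dots> = emeasure lborel A"
    using assms by (subst nn_integral_rotate) auto
  finally show "emeasure (distr lborel borel ((*) \<omega>)) A = emeasure lborel A" .
qed simp

text \<open>Substituting \<open>\<omega> * z\<close> for \<open>z\<close> multiplies the integral by
  \<open>\<omega> ^ m * cnj \<omega> ^ n\<close>, which differs from 1 for a suitable
  rotation.\<close>

lemma integral_monomial_rotation_invariant_eq_0:
  fixes w :: "complex \<Rightarrow> complex"
  assumes [measurable]: "w \<in> borel_measurable borel"
    and w: "\<And>\<omega> z. norm \<omega> = 1 \<Longrightarrow> w (\<omega> * z) = w z" and "m \<noteq> n"
  shows "(\<integral>z. z ^ m * cnj z ^ n * w z \<partial>lborel) = 0"
proof -
  have [measurable]: "cnj \<in> borel_measurable borel"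
    by (intro borel_measurable_continuous_onI continuous_intros)
  define J where "J = (\<integral>z. z ^ m * cnj z ^ n * w z \<partial>lborel)"
  \<comment> \<open>With this angle \<open>(m - n) * \<theta>\<close> is nonzero and at most 1 in
    absolute value, so its cosine is not 1. Also \<open>\<theta> < pi\<close> keeps
    \<open>\<omega>\<close> away from \<open>-1\<close>.\<close>
  define \<theta> where "\<theta> = 1 / (real m + real n)"
  define \<omega> where "\<omega> = cis \<theta>"
  have \<theta>: "0 < \<theta>" "\<theta> \<le> 1"
    using \<open>m \<noteq> n\<close> by (auto simp: \<theta>_def divide_le_eq)
  have "\<theta> < pi" using \<theta>(2) pi_gt3 by linarith
  then have "cos pi < cos \<theta>" using \<theta> by (intro cos_monotone_0_pi) auto
  then have \<omega>: "norm \<omega> = 1" "Re \<omega> \<noteq> -1" by (simp_all add: \<omega>_def)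
  have "J = (\<integral>z. z ^ m * cnj z ^ n * w z \<partial>distr lborel borel ((*) \<omega>))"
    using \<omega> by (simp add: J_def distr_lborel_rotate)
  also have "\<dots> = (\<integral>z. (\<omega> * z) ^ m * cnj (\<omega> * z) ^ n * w (\<omega> * z) \<partial>lborel)"
    by (intro integral_distr) auto
  also have "\<dots> = (\<integral>z. (\<omega> ^ m * cnj \<omega> ^ n) * (z ^ m * cnj z ^ n * w z) \<partial>lborel)"
    using w[OF \<omega>(1)] by (intro Bochner_Integration.integral_cong) (auto simp: power_mult_distrib)
  also have "\<dots> = (\<omega> ^ m * cnj \<omega> ^ n) * J"
    by (simp add: J_def)
  finally have "(\<omega> ^ m * cnj \<omega> ^ n - 1) * J = 0" by (simp add: algebra_simps)
  moreover have "\<omega> ^ m * cnj \<omega> ^ n \<noteq> 1"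
  proof
    assume "\<omega> ^ m * cnj \<omega> ^ n = 1"
    then have "cis ((real m - real n) * \<theta>) = 1"
      by (simp add: \<omega>_def cis_cnj Complex.DeMoivre cis_mult algebra_simps)
    then have "cos ((real m - real n) * \<theta>) = 1"
      by (simp add: complex_eq_iff)
    moreover have "\<bar>(real m - real n) * \<theta>\<bar> \<le> 1"
      using \<open>m \<noteq> n\<close> by (auto simp: \<theta>_def abs_mult divide_le_eq)
    moreover have "(real m - real n) * \<theta> \<noteq> 0"
      using \<open>m \<noteq> n\<close> \<theta> by simp
    ultimately show False
      using cos_monotone_0_pi[of 0 "\<bar>(real m - real n) * \<theta>\<bar>"] pi_gt3 by auto
  qed
  ultimately show ?thesis by (simp add: J_def)
qed

text \<open>A truncated Parseval identity. For the partial sums \<open>p N\<close> orthogonality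
  gives equality with \<open>A N\<close>. Dominated convergence, with the constant bound
  \<open>C\<close> on the disc of radius \<open>\<rho>\<close>, identifies the limit, and
  \<open>A\<close> is increasing.\<close>

lemma integral_norm_power_series_sq_ge:
  fixes a :: "nat \<Rightarrow> complex"
  assumes "0 \<le> \<rho>" "\<rho> \<le> 1" and summ: "summable (\<lambda>n. norm (a n) * \<rho> ^ n)"
    and F: "\<And>z. norm z \<le> \<rho> \<Longrightarrow> (\<lambda>n. a n * z ^ n) sums F z"
    and [measurable]: "(\<lambda>z. indicator (cball 0 \<rho>) z * (norm (F z))\<^sup>2) \<in> borel_measurable borel"
  shows "(\<Sum>n<N. (norm (a n))\<^sup>2 * (\<integral>z. indicator (cball 0 \<rho>) z * (norm (z::complex) ^ (2 * n) * (1 - (norm z)\<^sup>2)) \<partial>lborel))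
    \<le> (\<integral>z. indicator (cball 0 \<rho>) z * (norm (F z))\<^sup>2 * (1 - (norm z)\<^sup>2) \<partial>lborel)"
proof -
  define w :: "complex \<Rightarrow> real" where "w z = indicator (cball 0 \<rho>) z * (1 - (norm z)\<^sup>2)" for z
  define p where "p N z = (\<Sum>n<N. a n * z ^ n)" for N z
  define A where "A N = (\<Sum>n<N. (norm (a n))\<^sup>2 * (\<integral>z. norm z ^ (2 * n) * w z \<partial>lborel))" for N
  define C where "C = (\<Sum>n. norm (a n) * \<rho> ^ n)"
  have [measurable]: "w \<in> borel_measurable borel"
    unfolding w_def
    by (intro borel_measurable_times borel_measurable_indicator borel_measurable_continuous_onI
        continuous_intros) auto
  have w_nonneg: "0 \<le> w z" for z
    using \<open>\<rho> \<le> 1\<close> by (auto simp: w_def indicator_def power_le_one)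
  have int: "integrable lborel (\<lambda>z. z ^ m * cnj z ^ n * of_real (w z))" for m n
  proof -
    have "integrable lborel (\<lambda>z::complex. indicator (cball 0 \<rho>) z *\<^sub>R (z ^ m * cnj z ^ n * of_real (1 - (norm z)\<^sup>2)))"
      by (intro borel_integrable_compact continuous_intros) auto
    also have "(\<lambda>z::complex. indicator (cball 0 \<rho>) z *\<^sub>R (z ^ m * cnj z ^ n * of_real (1 - (norm z)\<^sup>2)))
        = (\<lambda>z. z ^ m * cnj z ^ n * of_real (w z))"
      by (auto simp: fun_eq_iff w_def indicator_def)
    finally show ?thesis .
  qed
  have orth: "(\<integral>z. z ^ m * cnj z ^ n * of_real (w z) \<partial>lborel) = 0" if "m \<noteq> n" for m n
    using that by (intro integral_monomial_rotation_invariant_eq_0)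
      (auto simp: w_def norm_mult indicator_def)
  have diag: "(\<integral>z. z ^ n * cnj z ^ n * of_real (w z) \<partial>lborel) = of_real (\<integral>z. norm z ^ (2 * n) * w z \<partial>lborel)" for n
  proof -
    have "z ^ n * cnj z ^ n = of_real (norm z ^ (2 * n))" for z :: complex
      by (metis complex_norm_square of_real_power power_mult power_mult_distrib)
    then have "z ^ n * cnj z ^ n * of_real (w z) = of_real (norm z ^ (2 * n) * w z)" for z :: complex
      by simp
    then show ?thesis by (simp only: integral_complex_of_real)
  qed
  have p_sq: "complex_of_real ((norm (p N z))\<^sup>2 * w z)
      = (\<Sum>m<N. \<Sum>n<N. (a m * cnj (a n)) * (z ^ m * cnj z ^ n * of_real (w z)))" for N z
  proof -
    have "complex_of_real ((norm (p N z))\<^sup>2 * w z) = p N z * cnj (p N z) * of_real (w z)"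
      by (simp add: complex_norm_square del: of_real_power)
    also have "p N z * cnj (p N z) = (\<Sum>m<N. \<Sum>n<N. (a m * z ^ m) * (cnj (a n) * cnj z ^ n))"
      unfolding p_def cnj_sum sum_product by simp
    finally show ?thesis
      unfolding sum_distrib_right by (simp add: mult_ac)
  qed
  have "complex_of_real (\<integral>z. (norm (p N z))\<^sup>2 * w z \<partial>lborel) = of_real (A N)" for N
  proof -
    have "complex_of_real (\<integral>z. (norm (p N z))\<^sup>2 * w z \<partial>lborel)
        = (\<integral>z. (\<Sum>m<N. \<Sum>n<N. (a m * cnj (a n)) * (z ^ m * cnj z ^ n * of_real (w z))) \<partial>lborel)"
      unfolding p_sq[symmetric] by (rule integral_complex_of_real[symmetric])
    also have "\<dots> = (\<Sum>m<N. \<Sum>n<N. (a m * cnj (a n)) * (\<integral>z. z ^ m * cnj z ^ n * of_real (w z) \<partial>lborel))"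
      using int by (subst Bochner_Integration.integral_sum, simp)+ simp
    also have "\<dots> = (\<Sum>m<N. \<Sum>n<N. if n = m then of_real ((norm (a n))\<^sup>2 * (\<integral>z. norm z ^ (2 * n) * w z \<partial>lborel)) else 0)"
      by (intro sum.cong refl) (auto simp: orth diag complex_norm_square simp del: of_real_power)
    also have "\<dots> = of_real (A N)"
      by (simp add: A_def)
    finally show ?thesis .
  qed
  then have A_eq: "A N = (\<integral>z. (norm (p N z))\<^sup>2 * w z \<partial>lborel)" for N
    using of_real_eq_iff by metis
  have "(\<lambda>N. \<integral>z. (norm (p N z))\<^sup>2 * w z \<partial>lborel)
      \<longlonglongrightarrow> (\<integral>z. indicator (cball 0 \<rho>) z * (norm (F z))\<^sup>2 * (1 - (norm z)\<^sup>2) \<partial>lborel)"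
  proof (rule integral_dominated_convergence)
    show "integrable lborel (\<lambda>z. C\<^sup>2 * w z)"
    proof -
      have "integrable lborel (\<lambda>z::complex. indicator (cball 0 \<rho>) z *\<^sub>R (1 - (norm z)\<^sup>2))"
        by (intro borel_integrable_compact continuous_intros) auto
      then show ?thesis by (simp add: w_def[abs_def])
    qed
    show "AE z in lborel. (\<lambda>N. (norm (p N z))\<^sup>2 * w z)
        \<longlonglongrightarrow> indicator (cball 0 \<rho>) z * (norm (F z))\<^sup>2 * (1 - (norm z)\<^sup>2)"
    proof (intro AE_I2)
      fix z :: complex
      show "(\<lambda>N. (norm (p N z))\<^sup>2 * w z)
        \<longlonglongrightarrow> indicator (cball 0 \<rho>) z * (norm (F z))\<^sup>2 * (1 - (norm z)\<^sup>2)"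
      proof (cases "norm z \<le> \<rho>")
        case True
        then have "(\<lambda>N. p N z) \<longlonglongrightarrow> F z"
          using F by (simp add: p_def sums_def)
        then have "(\<lambda>N. (norm (p N z))\<^sup>2 * w z) \<longlonglongrightarrow> (norm (F z))\<^sup>2 * w z"
          by (intro tendsto_intros)
        then show ?thesis using True by (simp add: w_def)
      qed (simp add: w_def)
    qed
    show "AE z in lborel. norm ((norm (p N z))\<^sup>2 * w z) \<le> C\<^sup>2 * w z" for N
    proof (intro AE_I2)
      fix z :: complex
      show "norm ((norm (p N z))\<^sup>2 * w z) \<le> C\<^sup>2 * w z"
      proof (cases "norm z \<le> \<rho>")
        case True
        have "norm (p N z) \<le> (\<Sum>n<N. norm (a n) * \<rho> ^ n)"
          unfolding p_def using True
          by (intro sum_norm_le) (auto simp: norm_mult norm_power intro!: mult_left_mono power_mono)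
        also have "\<dots> \<le> C"
          unfolding C_def using summ \<open>0 \<le> \<rho>\<close> by (intro sum_le_suminf) auto
        finally have "(norm (p N z))\<^sup>2 \<le> C\<^sup>2" by (intro power_mono) auto
        then show ?thesis using w_nonneg[of z] by (simp add: abs_mult mult_right_mono)
      qed (simp add: w_def)
    qed
    show "(\<lambda>z. (norm (p N z))\<^sup>2 * w z) \<in> borel_measurable lborel" for N
      unfolding p_def by measurable
  qed measurable
  then have lim: "A \<longlonglongrightarrow> (\<integral>z. indicator (cball 0 \<rho>) z * (norm (F z))\<^sup>2 * (1 - (norm z)\<^sup>2) \<partial>lborel)"
    by (simp add: A_eq[abs_def])
  have "incseq A"
    unfolding A_def using w_nonneg
    by (intro incseq_SucI) (auto intro!: mult_nonneg_nonneg Bochner_Integration.integral_nonneg)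
  from incseq_le[OF this lim, of N] show ?thesis
    by (simp add: A_def w_def mult_ac)
qed

section \<open>Lower bounds for the moments of the weight\<close>

lemma measure_annulus:
  fixes r s :: real
  assumes "0 \<le> r" "r \<le> s"
  shows "measure lborel (cball (0::complex) s - ball 0 r) = pi * (s\<^sup>2 - r\<^sup>2)"
proof -
  have "measure lborel (cball (0::complex) s - ball 0 r)
      = measure lborel (cball (0::complex) s) - measure lborel (ball (0::complex) r)"
    using assms by (intro measure_Diff) (auto simp: emeasure_cball)
  also have "\<dots> = pi * (s\<^sup>2 - r\<^sup>2)"
    using assms by (simp add: content_cball content_ball unit_ball_vol_2 algebra_simps)
  finally show ?thesis .
qed

text \<open>Over the full unit disc the moment equals \<open>pi / ((n + 1) * (n + 2))\<close>. A
  bound of this order already comes from one annulus at distance about \<open>1 / (n + 1)\<close>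
  from the circle, and \<open>\<rho>\<close> is large enough to contain the annuli for all
  \<open>n < N\<close>.\<close>

lemma integral_norm_power_weight_ge:
  fixes \<rho> :: real
  assumes "n < N" and \<rho>: "\<rho> = 1 - 1 / (8 * real N)"
  shows "pi / (128 * (real n + 1)\<^sup>2)
    \<le> (\<integral>z. indicator (cball 0 \<rho>) z * (norm (z::complex) ^ (2 * n) * (1 - (norm z)\<^sup>2)) \<partial>lborel)"
proof -
  define k where "k = real n + 1"
  have k: "1 \<le> k" "k \<le> real N" using assms by (auto simp: k_def)
  \<comment> \<open>On the annulus between \<open>r\<close> and \<open>s\<close>, Bernoulli's
    inequality gives \<open>1 / 2 \<le> norm z ^ (2 * n)\<close>, the weight is at least
    \<open>1 / (8 * k)\<close>, and the area is at least \<open>pi / (8 * k)\<close>. The product of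
    the three bounds is \<open>pi / (128 * k\<^sup>2)\<close>.\<close>
  define s where "s = 1 - 1 / (8 * k)"
  define r where "r = 1 - 1 / (4 * k)"
  have "1 / (8 * real N) \<le> 1 / (8 * k)"
    using k by (intro divide_left_mono) auto
  then have s_le: "s \<le> \<rho>" by (simp add: s_def \<rho>)
  have \<rho>1: "\<rho> \<le> 1" using k by (simp add: \<rho>)
  have k4: "1 / (4 * k) \<le> 1 / 4" "1 / (4 * k) = 2 * (1 / (8 * k))" "0 < 1 / (8 * k)"
    using k by (auto simp: field_simps)
  have rs: "1/2 \<le> r" "r \<le> s" "s < 1" "s - r = 1 / (8 * k)"
    using k4 unfolding r_def s_def by linarith+
  have pow: "1 / 2 \<le> r ^ (2 * n)"
  proof -
    have "1 + real (2 * n) * (r - 1) \<le> (1 + (r - 1)) ^ (2 * n)"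
      using rs by (intro Bernoulli_inequality) linarith
    moreover have "1 / 2 \<le> 1 + real (2 * n) * (r - 1)"
      using k by (simp add: r_def k_def field_simps)
    ultimately show ?thesis by simp
  qed
  have "pi / (128 * k\<^sup>2) = 1 / (16 * k) * (pi * (1 / (8 * k)))"
    using k by (simp add: field_simps power2_eq_square)
  also have "\<dots> \<le> 1 / (16 * k) * measure lborel (cball (0::complex) s - ball 0 r)"
  proof (intro mult_left_mono)
    have "1 * (s - r) \<le> (s + r) * (s - r)"
      using rs(1,2) by (intro mult_right_mono) linarith+
    also have "(s + r) * (s - r) = s\<^sup>2 - r\<^sup>2"
      by (simp add: power2_eq_square algebra_simps)
    finally have "1 / (8 * k) \<le> s\<^sup>2 - r\<^sup>2"
      using rs(4) by simp
    then show "pi * (1 / (8 * k)) \<le> measure lborel (cball (0::complex) s - ball 0 r)"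
      using rs by (subst measure_annulus) (auto intro: mult_left_mono simp del: times_divide_eq_right)
  qed (use k in auto)
  also have "\<dots> = (\<integral>z. indicator (cball (0::complex) s - ball 0 r) z * (1 / (16 * k)) \<partial>lborel)"
    by simp
  also have "\<dots> \<le> (\<integral>z. indicator (cball 0 \<rho>) z * (norm (z::complex) ^ (2 * n) * (1 - (norm z)\<^sup>2)) \<partial>lborel)"
  proof (intro integral_mono)
    have "emeasure lborel (cball (0::complex) s - ball 0 r) \<le> emeasure lborel (cball (0::complex) s)"
      by (intro emeasure_mono) auto
    also have "\<dots> < \<infinity>" using rs by (simp add: emeasure_cball)
    finally have "emeasure lborel (cball (0::complex) s - ball 0 r) < \<infinity>" .
    then show "integrable lborel (\<lambda>z::complex. indicator (cball 0 s - ball 0 r) z * (1 / (16 * k)))"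
      by (intro integrable_mult_left integrable_real_indicator) auto
    have "integrable lborel (\<lambda>z::complex. indicator (cball 0 \<rho>) z *\<^sub>R (norm z ^ (2 * n) * (1 - (norm z)\<^sup>2)))"
      by (intro borel_integrable_compact continuous_intros) auto
    then show "integrable lborel (\<lambda>z::complex. indicator (cball 0 \<rho>) z * (norm z ^ (2 * n) * (1 - (norm z)\<^sup>2)))"
      by simp
    fix z :: complex
    show "indicator (cball 0 s - ball 0 r) z * (1 / (16 * k))
        \<le> indicator (cball 0 \<rho>) z * (norm z ^ (2 * n) * (1 - (norm z)\<^sup>2))"
    proof (cases "z \<in> cball 0 s - ball 0 r")
      case True
      then have z: "r \<le> norm z" "norm z \<le> s" by (auto simp: not_less)
      have "1 / 2 \<le> norm z ^ (2 * n)"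
        using pow power_mono[OF z(1), of "2 * n"] rs by linarith
      moreover have "1 / (8 * k) \<le> 1 - (norm z)\<^sup>2"
      proof -
        have "norm z * norm z \<le> norm z * 1" using z rs by (intro mult_left_mono) auto
        then show ?thesis using z by (simp add: power2_eq_square s_def)
      qed
      ultimately have "1 / 2 * (1 / (8 * k)) \<le> norm z ^ (2 * n) * (1 - (norm z)\<^sup>2)"
        using k by (intro mult_mono) auto
      then show ?thesis using True z s_le by (simp add: indicator_def)
    next
      case False
      then show ?thesis using \<rho>1 by (auto simp: indicator_def power_le_one)
    qed
  qed
  finally show ?thesis by (simp add: k_def)
qed

text \<open>The truncated Parseval bound and the moment bound combine on a disc whose radius depends
  on \<open>N\<close>. The resulting constant \<open>128 / pi * I\<close> does not, so all partial
  sums are bounded.\<close>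

theorem square_summable_if_weighted_Bergman:
  fixes a :: "nat \<Rightarrow> complex"
  assumes F: "\<And>z. norm z < 1 \<Longrightarrow> (\<lambda>n. a n * z ^ n) sums F z"
    and hol: "F holomorphic_on ball 0 1"
    and fin: "(\<integral>\<^sup>+z. ennreal (indicator (ball 0 1) z * (norm (F z))\<^sup>2 * (1 - (norm z)\<^sup>2)) \<partial>lborel) < \<infinity>"
  shows "summable (\<lambda>n. (norm (a n) / (real n + 1))\<^sup>2)"
proof -
  define I where "I = enn2real (\<integral>\<^sup>+z. ennreal (indicator (ball 0 1) z * (norm (F z))\<^sup>2 * (1 - (norm z)\<^sup>2)) \<partial>lborel)"
  have "(\<Sum>n<N. (norm (a n) / (real n + 1))\<^sup>2) \<le> 128 / pi * I" for N
  proof (cases "N = 0")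
    case False
    define \<rho> where "\<rho> = 1 - 1 / (8 * real N)"
    have \<rho>: "0 \<le> \<rho>" "\<rho> < 1" using False by (auto simp: \<rho>_def)
    have sub: "cball (0::complex) \<rho> \<subseteq> ball 0 1" using \<rho> by auto
    \<comment> \<open>Convergence at the midpoint of \<open>\<rho>\<close> and 1 forces absolute
      convergence at \<open>\<rho>\<close>.\<close>
    have "summable (\<lambda>n. norm (a n * of_real \<rho> ^ n))"
    proof (rule powser_insidea)
      show "summable (\<lambda>n. a n * of_real ((1 + \<rho>) / 2) ^ n)"
        using F[of "of_real ((1 + \<rho>) / 2)"] \<rho> unfolding norm_of_real by (auto simp: sums_iff)
    qed (use \<rho> in \<open>unfold norm_of_real, auto\<close>)
    then have summ: "summable (\<lambda>n. norm (a n) * \<rho> ^ n)"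
      using \<rho> by (simp add: norm_mult norm_power)
    have cont: "continuous_on (cball 0 \<rho>) F"
      using hol sub by (meson continuous_on_subset holomorphic_on_imp_continuous_on)
    have int: "integrable lborel (\<lambda>z. indicator (cball 0 \<rho>) z *\<^sub>R (norm (F z))\<^sup>2)"
      using cont by (intro borel_integrable_compact continuous_intros) auto
    have int': "integrable lborel (\<lambda>z. indicator (cball 0 \<rho>) z *\<^sub>R ((norm (F z))\<^sup>2 * (1 - (norm z)\<^sup>2)))"
      using cont by (intro borel_integrable_compact continuous_intros) auto
    have "(\<Sum>n<N. (norm (a n) / (real n + 1))\<^sup>2) * (pi / 128)
        = (\<Sum>n<N. (norm (a n))\<^sup>2 * (pi / (128 * (real n + 1)\<^sup>2)))"
      unfolding sum_distrib_right by (intro sum.cong refl) (simp add: power_divide field_simps)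
    also have "\<dots> \<le> (\<Sum>n<N. (norm (a n))\<^sup>2 *
        (\<integral>z. indicator (cball 0 \<rho>) z * (norm (z::complex) ^ (2 * n) * (1 - (norm z)\<^sup>2)) \<partial>lborel))"
      using integral_norm_power_weight_ge[of _ N \<rho>] by (intro sum_mono mult_left_mono) (auto simp: \<rho>_def)
    also have "\<dots> \<le> (\<integral>z. indicator (cball 0 \<rho>) z * (norm (F z))\<^sup>2 * (1 - (norm z)\<^sup>2) \<partial>lborel)"
      using \<rho> summ F borel_measurable_integrable[OF int]
      by (intro integral_norm_power_series_sq_ge) auto
    also have "\<dots> \<le> I"
    proof -
      have "ennreal (\<integral>z. indicator (cball 0 \<rho>) z * (norm (F z))\<^sup>2 * (1 - (norm z)\<^sup>2) \<partial>lborel)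
          = (\<integral>\<^sup>+z. ennreal (indicator (cball 0 \<rho>) z * (norm (F z))\<^sup>2 * (1 - (norm z)\<^sup>2)) \<partial>lborel)"
        using int' \<rho> by (intro nn_integral_eq_integral[symmetric])
          (auto simp: mult.assoc indicator_def power_le_one)
      also have "\<dots> \<le> (\<integral>\<^sup>+z. ennreal (indicator (ball 0 1) z * (norm (F z))\<^sup>2 * (1 - (norm z)\<^sup>2)) \<partial>lborel)"
        using \<rho> by (intro nn_integral_mono ennreal_leI) (auto simp: indicator_def power_le_one)
      also have "\<dots> = ennreal I"
        using fin by (simp add: I_def)
      finally show ?thesis
        by (simp add: I_def)
    qed
    finally show ?thesis by (simp add: field_simps)
  qed (simp add: I_def)
  then show ?thesis
    by (intro summableI_nonneg_bounded) auto
qed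

section \<open>Taylor coefficients of \<open>h k\<close>\<close>

lemma tcoeff_has_fps_expansion:
  "f has_fps_expansion F \<Longrightarrow> tcoeff f n = fps_nth F n"
  using fps_nth_fps_expansion[of f F n] by (simp add: tcoeff_def)

lemma nth_mult_inverse_one_minus_X:
  "fps_nth (F * inverse (1 - fps_X :: 'a::field fps)) n = (\<Sum>i\<le>n. fps_nth F i)"
proof -
  have "inverse (1 - fps_X) = Abs_fps (\<lambda>_. 1 :: 'a)"
    using fps_inverse_idempotent[of "Abs_fps (\<lambda>_. 1 :: 'a)"] by (simp add: fps_inverse_gp')
  then show ?thesis by (simp add: fps_mult_nth atLeast0AtMost)
qed

text \<open>The Taylor coefficients of \<open>(1 - z) h k z\<close>. The \<open>n\<close>-th coefficient of
  \<open>h k\<close> is then \<open>H\<^sub>n - H\<^bsub>n div k\<^esub> - ln k\<close>, with harmonic numbers \<open>H\<close>.\<close>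
definition log_coeff :: "nat \<Rightarrow> nat \<Rightarrow> real" where
  "log_coeff k n = (if n = 0 then - ln (real k) else 1 / real n - (if k dvd n then real k / real n else 0))"

lemma sums_log_coeff:
  assumes "norm z < 1" "0 < k"
  shows "(\<lambda>n. of_real (log_coeff k n) * z ^ n) sums (Ln (1 - z ^ k) - Ln (1 - z) - of_real (ln (real k)))"
proof -
  have Ln_sums: "(\<lambda>n. w ^ n / of_nat n) sums - Ln (1 - w)" if "norm w < 1" for w :: complex
    using sums_minus[OF Ln_series'[of "- w"]] that by simp
  have zk: "norm (z ^ k) < 1"
    using assms by (simp add: norm_power power_less_one_iff)
  have mono: "strict_mono (\<lambda>j. k * j)"
    using \<open>0 < k\<close> by (intro strict_monoI) simp
  \<comment> \<open>The logarithmic series in \<open>z ^ k\<close>, reindexed by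
    \<open>n = k * j\<close>, so that \<open>1 / j\<close> becomes \<open>k / n\<close>. The term at
    \<open>n = 0\<close> vanishes because division by zero yields 0.\<close>
  have "(\<lambda>n. if k dvd n then of_nat k * z ^ n / of_nat n else 0) sums - Ln (1 - z ^ k)"
  proof (subst sums_mono_reindex[OF mono, symmetric])
    show "(\<lambda>j. if k dvd k * j then of_nat k * z ^ (k * j) / of_nat (k * j) else 0) sums - Ln (1 - z ^ k)"
      using Ln_sums[OF zk] \<open>0 < k\<close> by (simp add: power_mult)
    fix n assume "n \<notin> range (\<lambda>j. k * j)"
    then show "(if k dvd n then of_nat k * z ^ n / of_nat n else 0) = 0"
      by (auto simp: dvd_def)
  qed
  from sums_add[OF sums_diff[OF Ln_sums[OF assms(1)] this] sums_single[of 0 "\<lambda>_. - of_real (ln (real k))"]]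
  have "(\<lambda>n. z ^ n / of_nat n - (if k dvd n then of_nat k * z ^ n / of_nat n else 0)
        + (if n = 0 then - of_real (ln (real k)) else 0)) sums
      (Ln (1 - z ^ k) - Ln (1 - z) - of_real (ln (real k)))"
    by (simp add: algebra_simps)
  also have "(\<lambda>n. z ^ n / of_nat n - (if k dvd n then of_nat k * z ^ n / of_nat n else 0)
        + (if n = 0 then - of_real (ln (real k)) else 0)) = (\<lambda>n. of_real (log_coeff k n) * z ^ n)"
    by (auto simp: fun_eq_iff log_coeff_def field_simps)
  finally show ?thesis .
qed

lemma tcoeff_h:
  assumes "0 < k"
  shows "tcoeff (h k) n = of_real (\<Sum>i\<le>n. log_coeff k i)"
proof -
  define L where "L = Abs_fps (\<lambda>n. complex_of_real (log_coeff k n))"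
  have "eventually (\<lambda>z::complex. z \<in> ball 0 1) (nhds 0)"
    by (intro eventually_nhds_in_open) auto
  then have "(\<lambda>z. Ln (1 - z ^ k) - Ln (1 - z) - of_real (ln (real k))) has_fps_expansion L"
    using sums_log_coeff[OF _ assms]
    by (intro has_fps_expansionI) (auto simp: L_def elim: eventually_mono)
  then have "h k has_fps_expansion L * inverse (1 - fps_X)"
    unfolding h_def[abs_def] divide_inverse
    by (intro has_fps_expansion_mult has_fps_expansion_inverse fps_expansion_intros) auto
  then show ?thesis
    by (simp add: tcoeff_has_fps_expansion nth_mult_inverse_one_minus_X L_def)
qed

text \<open>With \<open>i = k * j\<close> the nonzero terms are \<open>1 / j\<close>. In the
  induction the quotient \<open>n div k\<close> grows by one exactly when a new multiple of
  \<open>k\<close> is reached.\<close>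

lemma sum_multiples_eq_harm:
  assumes "0 < k"
  shows "(\<Sum>i\<in>{0<..n}. if k dvd i then real k / real i else 0) = harm (n div k)"
proof (induction n)
  case (Suc n)
  have ins: "{0<..Suc n} = insert (Suc n) {0<..n}" by auto
  show ?case
  proof (cases "k dvd Suc n")
    case True
    then obtain q where q: "Suc n = k * q" by blast
    then have "q \<noteq> 0" by (intro notI) simp
    have "Suc n div k = Suc (n div k)"
      using True by (simp add: div_Suc mod_eq_0_iff_dvd)
    moreover have "Suc n div k = q" using q assms by simp
    moreover have "real k / real (Suc n) = inverse (real q)"
      using assms \<open>q \<noteq> 0\<close> unfolding q by (simp add: field_simps)
    ultimately show ?thesis
      using Suc True unfolding ins by (simp add: harm_Suc del: of_nat_Suc)
  next
    case False
    then show ?thesis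
      using Suc unfolding ins by (simp add: div_Suc mod_eq_0_iff_dvd)
  qed
qed (simp add: harm_def)

text \<open>Boundedness in \<open>n\<close> of the coefficients of \<open>h k\<close> is what kills
  the boundary term in the later summation by parts. The difference \<open>harm n - harm q\<close>
  has at most \<open>n\<close> terms, each at most \<open>1 / (q + 1)\<close>, and
  \<open>n < k * (q + 1)\<close>.\<close>

lemma abs_sum_log_coeff_le:
  assumes "0 < k"
  shows "\<bar>\<Sum>i\<le>n. log_coeff k i\<bar> \<le> ln (real k) + real k"
proof -
  define q where "q = n div k"
  have q: "q \<le> n" "n < k * (q + 1)"
    using assms dividend_less_times_div[of k n] by (auto simp: q_def algebra_simps)
  have "{..n} = insert 0 {0<..n}" by auto
  then have "(\<Sum>i\<le>n. log_coeff k i) = - ln (real k) + (\<Sum>i\<in>{0<..n}. 1 / real i - (if k dvd i then real k / real i else 0))"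
    by (simp add: log_coeff_def)
  also have "(\<Sum>i\<in>{0<..n}. 1 / real i - (if k dvd i then real k / real i else 0)) = harm n - harm q"
    unfolding sum_subtractf sum_multiples_eq_harm[OF assms] q_def
    by (auto simp: harm_def inverse_eq_divide intro!: sum.cong)
  also have "harm n - harm q = (\<Sum>i\<in>{q<..n}. inverse (real i))"
  proof -
    have "{1..n} = {1..q} \<union> {q<..n}" using q by auto
    moreover have "(\<Sum>i\<in>{1..q} \<union> {q<..n}. inverse (real i)) = harm q + (\<Sum>i\<in>{q<..n}. inverse (real i))"
      by (subst sum.union_disjoint) (auto simp: harm_def)
    ultimately show ?thesis by (simp add: harm_def)
  qed
  finally have eq: "(\<Sum>i\<le>n. log_coeff k i) = - ln (real k) + (\<Sum>i\<in>{q<..n}. inverse (real i))" .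
  have "(\<Sum>i\<in>{q<..n}. inverse (real i)) \<le> real (card {q<..n}) * inverse (real (q + 1))"
    by (intro sum_bounded_above) (auto intro!: le_imp_inverse_le)
  also have "\<dots> \<le> real n * inverse (real (q + 1))"
    by (intro mult_right_mono) auto
  also have "\<dots> \<le> real k"
    using q(2) by (simp add: field_simps flip: of_nat_mult of_nat_add)
  finally have "(\<Sum>i\<in>{q<..n}. inverse (real i)) \<le> real k" .
  moreover have "0 \<le> (\<Sum>i\<in>{q<..n}. inverse (real i))"
    by (intro sum_nonneg) auto
  moreover have "0 \<le> ln (real k)" using assms by simp
  ultimately show ?thesis
    unfolding eq by linarith
qed

section \<open>Orthogonality in terms of coefficients\<close>

text \<open>In terms of functions: if \<open>f' / (1 - z)\<close> has coefficients \<open>(n + 1) x\<^sub>n\<close> with \<open>x \<in> \<ell>\<^sup>2\<close>, then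
  \<open>f = c + (z - 1) g\<close> with \<open>g \<in> H\<^sup>2\<close>; here \<open>b 0 = c\<close> and \<open>b (n + 1)\<close> is the \<open>n\<close>-th coefficient
  of \<open>g\<close>. Summation by parts in \<open>f\<^sub>n = (T\<^sub>n - T\<^bsub>n-1\<^esub>) / n\<close>, \<open>T\<^sub>n = \<Sum>m\<le>n. m f\<^sub>m\<close>, yields
  \<open>g\<^sub>n = (\<Sum>m>n. T\<^sub>m / (m (m + 1))) - T\<^sub>n / (n + 1)\<close>.\<close>
lemma ex_square_summable_differences:
  fixes f :: "nat \<Rightarrow> complex"
  assumes "summable (\<lambda>n. (norm (\<Sum>m\<le>n. of_nat (Suc m) * f (Suc m)) / (real n + 1))\<^sup>2)"
  obtains b where "summable (\<lambda>n. (norm (b n))\<^sup>2)" "\<And>n. f n = b n - b (Suc n)"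
proof -
  \<comment> \<open>After the index shift \<open>T n\<close> is the sum of \<open>m * f m\<close>
    over \<open>m \<le> n\<close>, so the hypothesis speaks of \<open>T (Suc n)\<close>. Likewise
    \<open>u n\<close> below is the sum of \<open>T m / (m * (m + 1))\<close> over
    \<open>m > n\<close>.\<close>
  define T where "T n = (\<Sum>m<n. of_nat (Suc m) * f (Suc m))" for n
  define x where "x n = norm (T (Suc n)) / (real n + 1)" for n
  define v where "v n = T (Suc n) / (of_nat (Suc n) * of_nat (Suc (Suc n)))" for n
  have sq: "summable (\<lambda>n. (x n)\<^sup>2)"
    using assms unfolding x_def T_def lessThan_Suc_atMost .
  have summ_q: "summable (\<lambda>n. x n / (real n + 1))"
    using summable_divide_of_square_summable[OF sq] by (simp add: x_def)
  have norm_v: "norm (v n) \<le> x n / (real n + 1)" for n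
  proof -
    have "norm (v n) = norm (T (Suc n)) / ((real n + 1) * (real n + 2))"
      by (simp add: v_def norm_divide norm_mult del: of_nat_Suc) (simp add: add_ac)
    also have "\<dots> \<le> norm (T (Suc n)) / ((real n + 1) * (real n + 1))"
      by (intro divide_left_mono mult_left_mono mult_pos_pos) auto
    finally show ?thesis by (simp add: x_def)
  qed
  have summ_v: "summable (\<lambda>n. norm (v n))"
    using norm_v by (intro summable_comparison_test'[OF summ_q]) auto
  define u where "u n = (\<Sum>m. v (m + n))" for n
  have summ_shift: "summable (\<lambda>m. norm (v (m + n)))" for n
    using summ_v summable_iff_shift[of "\<lambda>m. norm (v m)" n] by simp
  \<comment> \<open>The majorant is the Copson transform of \<open>x\<close>, which makes
    \<open>u\<close> square summable.\<close>
  have norm_u: "norm (u n) \<le> (\<Sum>m. x (m + n) / (real (m + n) + 1))" for n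
  proof -
    have "norm (u n) \<le> (\<Sum>m. norm (v (m + n)))"
      unfolding u_def by (intro summable_norm summ_shift)
    also have "\<dots> \<le> (\<Sum>m. x (m + n) / (real (m + n) + 1))"
      using summ_shift summ_q summable_iff_shift[of "\<lambda>m. x m / (real m + 1)" n]
      by (intro suminf_le norm_v) auto
    finally show ?thesis .
  qed
  have u_Suc: "u n = v n + u (Suc n)" for n
    using suminf_split_head[OF summable_norm_cancel[OF summ_shift[of n]]] by (simp add: u_def)
  have u_sq: "summable (\<lambda>n. (norm (u n))\<^sup>2)"
    using norm_u
    by (intro summable_comparison_test'[OF copson_square_summable[OF sq]]) (auto simp: x_def intro!: power_mono)
  define g where "g n = u n - T n / of_nat (Suc n)" for n
  have norm_T: "norm (T (Suc n) / of_nat (Suc (Suc n))) \<le> x n" for n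
  proof -
    have "norm (T (Suc n) / of_nat (Suc (Suc n))) = norm (T (Suc n)) / (real n + 2)"
      by (simp add: norm_divide del: of_nat_Suc)
    also have "\<dots> \<le> x n"
      unfolding x_def by (intro divide_left_mono) auto
    finally show ?thesis .
  qed
  have "summable (\<lambda>n. (norm (g (Suc n)))\<^sup>2)"
  proof (rule summable_comparison_test')
    show "summable (\<lambda>n. 2 * (norm (u (Suc n)))\<^sup>2 + 2 * (x n)\<^sup>2)"
      using u_sq sq by (intro summable_add summable_mult) (auto simp: summable_Suc_iff[of "\<lambda>n. (norm (u n))\<^sup>2"])
    fix n
    have "norm (g (Suc n)) \<le> norm (u (Suc n)) + x n"
      unfolding g_def using norm_T[of n] by (intro order_trans[OF norm_triangle_ineq4]) auto
    then have "(norm (g (Suc n)))\<^sup>2 \<le> (norm (u (Suc n)) + x n)\<^sup>2"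
      by (intro power_mono) auto
    also have "\<dots> \<le> 2 * (norm (u (Suc n)))\<^sup>2 + 2 * (x n)\<^sup>2"
      using zero_le_power2[of "norm (u (Suc n)) - x n"] by (simp add: power2_eq_square algebra_simps)
    finally show "norm ((norm (g (Suc n)))\<^sup>2) \<le> 2 * (norm (u (Suc n)))\<^sup>2 + 2 * (x n)\<^sup>2" by simp
  qed
  then have g_sq: "summable (\<lambda>n. (norm (g n))\<^sup>2)"
    by (subst (asm) summable_Suc_iff)
  have diff: "f (Suc n) = g n - g (Suc n)" for n
  proof -
    define p :: complex where "p = of_nat (Suc n)"
    have p3: "of_nat (Suc (Suc n)) = p + 1"
      unfolding p_def by simp
    have p: "p \<noteq> 0" "p + 1 \<noteq> 0"
      unfolding p3[symmetric] unfolding p_def by (rule of_nat_neq_0)+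
    have T_Suc: "T (Suc n) = T n + p * f (Suc n)"
      by (simp add: T_def p_def)
    have "g n - g (Suc n) = T (Suc n) / (p * (p + 1)) - T n / p + T (Suc n) / (p + 1)"
      using u_Suc[of n] p3 by (simp add: g_def v_def p_def[symmetric] del: of_nat_Suc)
    also have "\<dots> = (T (Suc n) - T n) / p"
      using p by (simp add: divide_simps) (simp add: algebra_simps)
    also have "\<dots> = f (Suc n)" using p(1) by (simp add: T_Suc)
    finally show ?thesis ..
  qed
  show thesis
  proof (rule that)
    \<comment> \<open>The value at 0 is forced by \<open>f 0 = b 0 - b 1\<close>. Since
      \<open>b\<close> tends to 0, telescoping shows that \<open>b 0\<close> is the sum of all
      \<open>f n\<close>.\<close>
    define b where "b n = (case n of 0 \<Rightarrow> f 0 + g 0 | Suc m \<Rightarrow> g m)" for n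
    show "summable (\<lambda>n. (norm (b n))\<^sup>2)"
      using g_sq by (subst summable_Suc_iff[symmetric]) (simp add: b_def)
    show "f n = b n - b (Suc n)" for n
      using diff by (cases n) (simp_all add: b_def)
  qed
qed

text \<open>The factor \<open>k\<close> turns the sum into that of \<open>b (k * j) / j\<close>. By
  Cauchy-Schwarz it is at most \<open>sqrt C\<close> times the \<ell>2 norm of the values
  \<open>b (k * j)\<close>, whose indices are all at least \<open>k\<close>; this is controlled by
  the tail \<open>R k\<close>.\<close>

lemma tendsto_sum_multiples_divide:
  fixes b :: "nat \<Rightarrow> complex"
  assumes sq: "summable (\<lambda>n. (norm (b n))\<^sup>2)"
  shows "(\<lambda>k. of_nat k * (\<Sum>\<^sub>\<infinity>j\<in>{0<..}. b (k * j) / of_nat (k * j))) \<longlonglongrightarrow> 0"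
proof (rule Lim_null_comparison)
  define C where "C = (\<Sum>n. inverse ((real n)\<^sup>2))"
  define R where "R k = (\<Sum>n. (norm (b (n + k)))\<^sup>2)" for k
  have summ_C: "summable (\<lambda>n. inverse ((real n)\<^sup>2))"
    using inverse_power_summable[of 2, where 'a = real] by simp
  have finite_le: "(\<Sum>j\<in>A. norm (b (k * j)) / real j) \<le> sqrt (R k) * sqrt C"
    \<comment> \<open>A bound uniform in the finite set \<open>A\<close> yields both absolute
      summability and the estimate of the infinite sum.\<close>
    if "0 < k" "finite A" "A \<subseteq> {0<..}" for k A
  proof -
    have "(\<Sum>j\<in>A. norm (b (k * j)) / real j) = (\<Sum>j\<in>A. \<bar>norm (b (k * j))\<bar> * \<bar>inverse (real j)\<bar>)"
      by (simp add: divide_inverse)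
    also have "\<dots> \<le> L2_set (\<lambda>j. norm (b (k * j))) A * L2_set (\<lambda>j. inverse (real j)) A"
      by (rule L2_set_mult_ineq)
    also have "\<dots> \<le> sqrt (R k) * sqrt C"
    proof (intro mult_mono)
      \<comment> \<open>Subtracting \<open>k\<close> places the indices in the shifted series
        defining \<open>R k\<close>. The natural subtraction does not truncate since
        \<open>j \<ge> 1\<close>.\<close>
      have "(\<Sum>j\<in>A. (norm (b (k * j)))\<^sup>2) = (\<Sum>n\<in>(\<lambda>j. k * j - k) ` A. (norm (b (n + k)))\<^sup>2)"
      proof (subst sum.reindex)
        show "inj_on (\<lambda>j. k * j - k) A"
        proof (rule inj_onI)
          fix i j assume "i \<in> A" "j \<in> A" "k * i - k = k * j - k"
          moreover have "k \<le> k * i" "k \<le> k * j" using that(3) \<open>i \<in> A\<close> \<open>j \<in> A\<close> by auto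
          ultimately have "k * i = k * j" by linarith
          then show "i = j" using \<open>0 < k\<close> by simp
        qed
        have "k * j - k + k = k * j" if "j \<in> A" for j
          using that \<open>A \<subseteq> {0<..}\<close> by (intro le_add_diff_inverse2) auto
        then show "(\<Sum>j\<in>A. (norm (b (k * j)))\<^sup>2) = sum ((\<lambda>n. (norm (b (n + k)))\<^sup>2) \<circ> (\<lambda>j. k * j - k)) A"
          by (intro sum.cong) auto
      qed
      also have "\<dots> \<le> R k"
        unfolding R_def using sq that(2) summable_iff_shift[of "\<lambda>n. (norm (b n))\<^sup>2" k]
        by (intro sum_le_suminf) auto
      finally show "L2_set (\<lambda>j. norm (b (k * j))) A \<le> sqrt (R k)"
        by (simp add: L2_set_def)
      have "(\<Sum>j\<in>A. (inverse (real j))\<^sup>2) \<le> C"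
        unfolding C_def power_inverse using summ_C that(2) by (intro sum_le_suminf) auto
      then show "L2_set (\<lambda>j. inverse (real j)) A \<le> sqrt C"
        by (simp add: L2_set_def)
    qed (auto simp: L2_set_nonneg R_def intro!: suminf_nonneg
          summable_iff_shift[of "\<lambda>n. (norm (b n))\<^sup>2", THEN iffD2] sq)
    finally show ?thesis .
  qed
  show "eventually (\<lambda>k. norm (of_nat k * (\<Sum>\<^sub>\<infinity>j\<in>{0<..}. b (k * j) / of_nat (k * j))) \<le> sqrt (R k) * sqrt C) sequentially"
    using eventually_gt_at_top[of 0]
  proof eventually_elim
    case (elim k)
    have "of_nat k * (\<Sum>\<^sub>\<infinity>j\<in>{0<..}. b (k * j) / of_nat (k * j)) = (\<Sum>\<^sub>\<infinity>j\<in>{0<..}. b (k * j) / of_nat j)"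
      using elim by (subst infsum_cmult_right'[symmetric]) (intro infsum_cong, simp)
    moreover have bdd: "bdd_above (sum (\<lambda>j. norm (b (k * j) / of_nat j)) ` {F. F \<subseteq> {0<..} \<and> finite F})"
      using finite_le[OF elim] by (intro bdd_aboveI[of _ "sqrt (R k) * sqrt C"]) (auto simp: norm_divide)
    moreover have "norm (\<Sum>\<^sub>\<infinity>j\<in>{0<..}. b (k * j) / of_nat j) \<le> sqrt (R k) * sqrt C"
    proof -
      have summ: "(\<lambda>j. norm (b (k * j) / of_nat j)) summable_on {0<..}"
        using bdd by (intro nonneg_bdd_above_summable_on) auto
      then have "norm (\<Sum>\<^sub>\<infinity>j\<in>{0<..}. b (k * j) / of_nat j) \<le> (\<Sum>\<^sub>\<infinity>j\<in>{0<..}. norm (b (k * j) / of_nat j))"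
        by (rule norm_infsum_bound)
      also have "\<dots> \<le> sqrt (R k) * sqrt C"
        using summ finite_le[OF elim] by (intro infsum_le_finite_sums) (auto simp: norm_divide)
      finally show ?thesis .
    qed
    ultimately show ?case by simp
  qed
  have "R \<longlonglongrightarrow> 0"
    unfolding R_def using suminf_exist_split2[OF sq] by simp
  then show "(\<lambda>k. sqrt (R k) * sqrt C) \<longlonglongrightarrow> 0"
    using tendsto_mult_left_zero[of "\<lambda>k. sqrt (R k)"] tendsto_real_sqrt[of R 0] by simp
qed

text \<open>The hypothesis \<open>Ces\<close> is the common ground of the two classes of functions
  treated at the end: finite local Dirichlet integral and holomorphy across the unit circle.\<close>

theorem coefficients_eq_0_if_orthogonal_to_h:
  assumes Ces: "summable (\<lambda>n. (norm (\<Sum>m\<le>n. of_nat (Suc m) * tcoeff f (Suc m)) / (real n + 1))\<^sup>2)"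
    and orth: "\<And>k. 2 \<le> k \<Longrightarrow> H2_inner f (h k) = 0"
  shows "tcoeff f n = 0"
proof -
  obtain b where sq: "summable (\<lambda>n. (norm (b n))\<^sup>2)" and diff: "\<And>n. tcoeff f n = b n - b (Suc n)"
    using ex_square_summable_differences[OF Ces] by blast
  \<comment> \<open>Here \<open>c 0 = 0\<close> by division by zero. Sums over all \<open>n\<close>
    therefore agree with sums over positive \<open>n\<close>, also when restricted to the multiples
    of \<open>k\<close>.\<close>
  define c where "c n = b n / of_nat n" for n
  have summ_c: "summable (\<lambda>n. norm (c n))"
  proof -
    have "summable (\<lambda>n. (norm (b (Suc n)))\<^sup>2)"
      using sq by (subst summable_Suc_iff)
    from summable_divide_of_square_summable[OF this]
    have "summable (\<lambda>n. norm (b (Suc n)) / real (Suc n))"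
      by (simp add: add.commute)
    then show ?thesis
      by (subst summable_Suc_iff[symmetric]) (simp add: c_def norm_divide del: of_nat_Suc)
  qed
  have c_on: "c summable_on A" for A
    using summ_c norm_summable_imp_summable_on summable_on_subset_banach by blast
  define A where "A = (\<Sum>\<^sub>\<infinity>n. c n)"
  define B where "B k = of_nat k * (\<Sum>\<^sub>\<infinity>j\<in>{0<..}. c (k * j))" for k
  have B_lim: "B \<longlonglongrightarrow> 0"
    using tendsto_sum_multiples_divide[OF sq] by (simp add: B_def[abs_def] c_def)
  have abel: "(\<Sum>n<N. (b n - b (Suc n)) * (\<Sum>i\<le>n. d i)) = (\<Sum>n<N. b n * d n) - b N * (\<Sum>i<N. d i)"
    for d :: "nat \<Rightarrow> complex" and N
    by (induction N) (simp_all add: lessThan_Suc_atMost[symmetric] algebra_simps)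
  \<comment> \<open>By \<open>abel\<close> the difference in \<open>tcoeff f n\<close> moves onto
    \<open>h k\<close>, whose coefficients are the partial sums of \<open>d\<close>. The series of
    \<open>b n * d n\<close> splits along \<open>log_coeff\<close> into \<open>A\<close>,
    \<open>B k\<close> and the constant term. The boundary term vanishes, as \<open>b\<close> tends
    to 0 and the partial sums are bounded.\<close>
  have B_eq: "B k = A - b 0 * of_real (ln (real k))" if "2 \<le> k" for k
  proof -
    define d where "d n = complex_of_real (log_coeff k n)" for n
    have "0 < k" using that by simp
    have b_lim: "b \<longlonglongrightarrow> 0"
      using summable_LIMSEQ_zero[OF sq] by (simp add: tendsto_norm_zero_iff)
    have boundary: "(\<lambda>N. b N * (\<Sum>i<N. d i)) \<longlonglongrightarrow> 0"
    proof (rule Lim_null_comparison)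
      have "norm (\<Sum>i<N. d i) \<le> ln (real k) + real k" for N
      proof (cases N)
        case 0
        then show ?thesis using \<open>0 < k\<close> by simp
      next
        case (Suc M)
        have "norm (\<Sum>i<N. d i) = \<bar>\<Sum>i\<le>M. log_coeff k i\<bar>"
          unfolding Suc lessThan_Suc_atMost d_def of_real_sum[symmetric] by (rule norm_of_real)
        then show ?thesis using abs_sum_log_coeff_le[OF \<open>0 < k\<close>] by simp
      qed
      then show "\<forall>\<^sub>F N in sequentially. norm (b N * (\<Sum>i<N. d i)) \<le> norm (b N) * (ln (real k) + real k)"
        by (intro always_eventually allI) (simp add: norm_mult mult_left_mono)
      show "(\<lambda>N. norm (b N) * (ln (real k) + real k)) \<longlonglongrightarrow> 0"
        using tendsto_mult_left_zero[OF tendsto_norm_zero[OF b_lim]] .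
    qed
    have "(\<Sum>\<^sub>\<infinity>j\<in>{0<..}. c (k * j)) = (\<Sum>\<^sub>\<infinity>n\<in>(*) k ` {0<..}. c n)"
      using \<open>0 < k\<close> by (subst infsum_reindex) (auto simp: inj_on_def o_def)
    also have "\<dots> = (\<Sum>\<^sub>\<infinity>n. if k dvd n then c n else 0)"
    proof (rule infsum_cong_neutral)
      fix n assume "n \<in> UNIV - (*) k ` {0<..}"
      then have "n = 0" if "k dvd n" using that by (cases "n = 0") auto
      then show "(if k dvd n then c n else 0) = 0" by (simp add: c_def)
    qed auto
    finally have mult_sum: "(\<Sum>\<^sub>\<infinity>j\<in>{0<..}. c (k * j)) = (\<Sum>\<^sub>\<infinity>n. if k dvd n then c n else 0)" .
    have "summable (\<lambda>n. norm (if k dvd n then c n else 0))"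
      by (rule summable_comparison_test'[OF summ_c]) auto
    then have "(\<lambda>n. if k dvd n then c n else 0) sums (\<Sum>\<^sub>\<infinity>j\<in>{0<..}. c (k * j))"
      unfolding mult_sum by (intro has_sum_imp_sums has_sum_infsum norm_summable_imp_summable_on)
    from sums_mult[OF this, of "of_nat k"]
    have "(\<lambda>n. of_nat k * (if k dvd n then c n else 0)) sums B k"
      by (simp add: B_def)
    moreover have "c sums A"
      unfolding A_def using c_on by (intro has_sum_imp_sums has_sum_infsum)
    moreover have "(\<lambda>n. if n = 0 then - b 0 * of_real (ln (real k)) else 0) sums (- b 0 * of_real (ln (real k)))"
      using sums_single[of 0 "\<lambda>_. - b 0 * of_real (ln (real k))"] by simp
    ultimately have "(\<lambda>n. c n - of_nat k * (if k dvd n then c n else 0)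
        + (if n = 0 then - b 0 * of_real (ln (real k)) else 0)) sums (A - B k + - b 0 * of_real (ln (real k)))"
      by (intro sums_add sums_diff)
    also have "(\<lambda>n. c n - of_nat k * (if k dvd n then c n else 0)
        + (if n = 0 then - b 0 * of_real (ln (real k)) else 0)) = (\<lambda>n. b n * d n)"
      by (auto simp: fun_eq_iff c_def d_def log_coeff_def field_simps)
    finally have "(\<lambda>N. \<Sum>n<N. b n * d n) \<longlonglongrightarrow> A - B k + - b 0 * of_real (ln (real k))"
      by (simp add: sums_def)
    \<comment> \<open>The coefficients of \<open>h k\<close> are real, so the conjugation in the
      inner product disappears.\<close>
    from tendsto_diff[OF this boundary]
    have "(\<lambda>n. tcoeff f n * cnj (tcoeff (h k) n)) sums (A - B k + - b 0 * of_real (ln (real k)))"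
      by (simp add: sums_def diff tcoeff_h[OF \<open>0 < k\<close>] abel[symmetric] d_def)
    then have "A - B k + - b 0 * of_real (ln (real k)) = 0"
      using orth[OF that] sums_unique by (force simp: H2_inner_def)
    then show ?thesis by (simp add: algebra_simps)
  qed
  text \<open>\<open>B k \<rightarrow> 0\<close>, whereas \<open>ln\<close> is unbounded.\<close>
  have "(\<lambda>k. B k - B (2 * k)) \<longlonglongrightarrow> 0 - 0"
    using filterlim_compose[OF B_lim mult_nat_left_at_top[of 2]] B_lim by (intro tendsto_diff) auto
  \<comment> \<open>Doubling \<open>k\<close> cancels \<open>A\<close> and leaves
    \<open>ln (2 * k) - ln k = ln 2\<close>.\<close>
  moreover have "eventually (\<lambda>k. B k - B (2 * k) = b 0 * of_real (ln 2)) sequentially"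
    using eventually_ge_at_top[of 2]
    by eventually_elim (simp add: B_eq ln_mult algebra_simps)
  ultimately have "(\<lambda>k::nat. b 0 * of_real (ln 2)) \<longlonglongrightarrow> 0"
    by (simp add: tendsto_cong)
  then have b0: "b 0 = 0"
    by (simp add: LIMSEQ_const_iff)
  have "eventually (\<lambda>k. B k = A) sequentially"
    using eventually_ge_at_top[of 2] by eventually_elim (simp add: B_eq b0)
  with B_lim have "(\<lambda>k::nat. A) \<longlonglongrightarrow> 0"
    by (simp add: tendsto_cong)
  then have A0: "A = 0" by (simp add: LIMSEQ_const_iff)
  have "(\<Sum>\<^sub>\<infinity>j\<in>{0<..}. c (k * j)) = 0" if "0 < k" for k
  \<comment> \<open>Orthogonality concerns only \<open>k \<ge> 2\<close>. For \<open>k = 1\<close>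
    the sum is \<open>A\<close> itself, already known to vanish.\<close>
  proof (cases "k = 1")
    case True
    have "(\<Sum>\<^sub>\<infinity>j\<in>{0<..}. c j) = A"
      unfolding A_def by (intro infsum_cong_neutral) (auto simp: c_def)
    then show ?thesis using True A0 by simp
  next
    case False
    then have "B k = 0" using that by (simp add: B_eq A0 b0)
    then show ?thesis using that by (simp add: B_def)
  qed
  then have "c k = 0" if "0 < k" for k
    using eq_0_if_sums_over_multiples_eq_0[OF summ_c _ that] by blast
  then have "b k = 0" for k
    using b0 by (cases "k = 0") (auto simp: c_def)
  then show ?thesis by (simp add: diff)
qed

section \<open>Functions of finite local Dirichlet integral\<close>

lemma sums_tcoeff:
  assumes "f holomorphic_on ball 0 r" "norm z < r"
  shows "(\<lambda>n. tcoeff f n * z ^ n) sums f z"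
  using holomorphic_power_series[OF assms(1), of z] assms(2) by (simp add: tcoeff_def)

lemma eq_0_if_tcoeff_eq_0:
  assumes "f holomorphic_on ball 0 r" "norm z < r" "\<And>n. tcoeff f n = 0"
  shows "f z = 0"
  using sums_tcoeff[OF assms(1,2)] assms(3) sums_unique2[OF _ sums_zero] by simp

lemma tcoeff_deriv: "tcoeff (deriv f) n = of_nat (Suc n) * tcoeff f (Suc n)"
proof -
  have "tcoeff f (Suc n) = (deriv ^^ n) (deriv f) 0 / (of_nat (Suc n) * of_nat (fact n))"
    unfolding tcoeff_def fact_Suc funpow_Suc_right of_nat_mult of_nat_id by (simp only: o_apply)
  moreover have "of_nat (Suc n) \<noteq> (0 :: complex)" by (rule of_nat_neq_0)
  ultimately show ?thesis by (simp add: tcoeff_def del: of_nat_Suc)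
qed

lemma tcoeff_deriv_divide_one_minus:
  assumes "f holomorphic_on ball 0 1"
  shows "tcoeff (\<lambda>z. deriv f z / (1 - z)) n = (\<Sum>m\<le>n. of_nat (Suc m) * tcoeff f (Suc m))"
proof -
  define D where "D = Abs_fps (tcoeff (deriv f))"
  have hol: "deriv f holomorphic_on ball 0 1"
    using assms by (intro holomorphic_deriv) auto
  have "eventually (\<lambda>z::complex. z \<in> ball 0 1) (nhds 0)"
    by (intro eventually_nhds_in_open) auto
  then have "deriv f has_fps_expansion D"
    using sums_tcoeff[OF hol]
    by (intro has_fps_expansionI) (auto simp: D_def elim: eventually_mono)
  then have "(\<lambda>z. deriv f z / (1 - z)) has_fps_expansion D * inverse (1 - fps_X)"
    unfolding divide_inverse
    by (intro has_fps_expansion_mult has_fps_expansion_inverse fps_expansion_intros) auto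
  then have "tcoeff (\<lambda>z. deriv f z / (1 - z)) n = (\<Sum>m\<le>n. tcoeff (deriv f) m)"
    by (simp add: tcoeff_has_fps_expansion nth_mult_inverse_one_minus_X D_def)
  then show ?thesis
    by (simp only: tcoeff_deriv)
qed

text \<open>Up to the factor \<open>pi\<close> the local Dirichlet integral of \<open>f\<close> is
  the weighted Bergman integral of \<open>F = f' / (1 - z)\<close>, and division by
  \<open>1 - z\<close> turns the coefficients of \<open>f'\<close> into their partial sums.\<close>

lemma square_summable_if_local_dirichlet_1:
  assumes "f \<in> local_dirichlet_1"
  shows "summable (\<lambda>n. (norm (\<Sum>m\<le>n. of_nat (Suc m) * tcoeff f (Suc m)) / (real n + 1))\<^sup>2)"
proof -
  define F where "F z = deriv f z / (1 - z)" for z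
  have hol: "f holomorphic_on ball 0 1"
    using assms by (simp add: local_dirichlet_1_def H2_def)
  have hol_F: "F holomorphic_on ball 0 1"
    unfolding F_def using hol by (intro holomorphic_intros holomorphic_deriv) auto
  define I where "I z = indicator (ball 0 1) z * (norm (deriv f z))\<^sup>2 * (1 - (norm z)\<^sup>2) / (norm (z - 1))\<^sup>2 / pi" for z
  have fin: "(\<integral>\<^sup>+z. ennreal (I z) \<partial>lborel) < \<infinity>"
    using assms by (simp add: local_dirichlet_1_def I_def)
  have cont: "continuous_on (ball 0 1) (\<lambda>z. (norm (F z))\<^sup>2 * (1 - (norm z)\<^sup>2))"
    using hol_F by (intro continuous_intros holomorphic_on_imp_continuous_on)
  have "(\<lambda>z. indicator (ball 0 1) z *\<^sub>R ((norm (F z))\<^sup>2 * (1 - (norm z)\<^sup>2))) \<in> borel_measurable borel"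
    using cont by (intro borel_measurable_continuous_on_indicator) auto
  then have [measurable]: "(\<lambda>z. indicator (ball 0 1) z * (norm (F z))\<^sup>2 * (1 - (norm z)\<^sup>2)) \<in> borel_measurable borel"
    by (simp add: mult.assoc)
  have I_eq: "I z = (indicator (ball 0 1) z * (norm (F z))\<^sup>2 * (1 - (norm z)\<^sup>2)) / pi" for z
    by (simp add: I_def F_def norm_divide power_divide norm_minus_commute)
  have "(\<integral>\<^sup>+z. ennreal (indicator (ball 0 1) z * (norm (F z))\<^sup>2 * (1 - (norm z)\<^sup>2)) \<partial>lborel)
      = (\<integral>\<^sup>+z. ennreal pi * ennreal (I z) \<partial>lborel)"
    by (intro nn_integral_cong) (simp add: I_eq ennreal_mult'[symmetric])
  also have "\<dots> = ennreal pi * (\<integral>\<^sup>+z. ennreal (I z) \<partial>lborel)"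
    by (intro nn_integral_cmult) (simp add: I_eq[abs_def])
  also have "\<dots> < \<infinity>"
    using fin by (simp add: ennreal_mult_less_top)
  finally have "(\<integral>\<^sup>+z. ennreal (indicator (ball 0 1) z * (norm (F z))\<^sup>2 * (1 - (norm z)\<^sup>2)) \<partial>lborel) < \<infinity>" .
  from square_summable_if_weighted_Bergman[OF sums_tcoeff[OF hol_F] hol_F this]
  show ?thesis
    using tcoeff_deriv_divide_one_minus[OF hol] by (simp add: F_def[abs_def])
qed

text \<open>The power series of \<open>f'\<close> converges at a point beyond 1, hence absolutely at
  1. Its coefficients then have bounded partial sums, and \<open>1 / (n + 1)\<^sup>2\<close> is
  summable. This avoids the Dirichlet integral altogether.\<close>

lemma square_summable_if_holomorphic_on_larger_ball:
  assumes "f holomorphic_on ball 0 r" "1 < r"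
  shows "summable (\<lambda>n. (norm (\<Sum>m\<le>n. of_nat (Suc m) * tcoeff f (Suc m)) / (real n + 1))\<^sup>2)"
proof -
  define s where "s = (1 + r) / 2"
  have s: "1 < s" "s < r" using assms(2) by (auto simp: s_def)
  have hol: "deriv f holomorphic_on ball 0 r"
    using assms by (intro holomorphic_deriv) auto
  have "summable (\<lambda>n. norm (tcoeff (deriv f) n * 1 ^ n))"
    using s sums_tcoeff[OF hol, of "of_real s"]
    by (intro powser_insidea[of _ "of_real s"]) (auto simp: sums_iff)
  then have summ: "summable (\<lambda>n. norm (of_nat (Suc n) * tcoeff f (Suc n)))"
    by (simp only: tcoeff_deriv power_one mult_1_right)
  define C where "C = (\<Sum>n. norm (of_nat (Suc n) * tcoeff f (Suc n)))"
  show ?thesis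
  proof (rule summable_comparison_test')
    have "summable (\<lambda>n. inverse ((real (Suc n))\<^sup>2))"
      using inverse_power_summable[of 2, where 'a = real] by (subst summable_Suc_iff) auto
    then show "summable (\<lambda>n. C\<^sup>2 * inverse ((real (Suc n))\<^sup>2))"
      by (rule summable_mult)
    fix n
    have "norm (\<Sum>m\<le>n. of_nat (Suc m) * tcoeff f (Suc m)) \<le> (\<Sum>m\<le>n. norm (of_nat (Suc m) * tcoeff f (Suc m)))"
      by (rule norm_sum)
    also have "\<dots> \<le> C"
      unfolding C_def using summ by (intro sum_le_suminf) auto
    finally have "(norm (\<Sum>m\<le>n. of_nat (Suc m) * tcoeff f (Suc m)))\<^sup>2 \<le> C\<^sup>2"
      by (intro power_mono) auto
    from mult_right_mono[OF this, of "inverse ((real (Suc n))\<^sup>2)"]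
    show "norm ((norm (\<Sum>m\<le>n. of_nat (Suc m) * tcoeff f (Suc m)) / (real n + 1))\<^sup>2)
        \<le> C\<^sup>2 * inverse ((real (Suc n))\<^sup>2)"
      by (simp add: power_divide divide_inverse power_mult_distrib power_inverse add.commute)
  qed
qed

section \<open>Conclusion for the local Dirichlet space and for functions holomorphic across the
  unit circle\<close>

theorem mainTheorem12:
  shows "(\<forall>f. f \<in> local_dirichlet_1 \<and> (\<forall>k\<ge>2. H2_inner f (h k) = 0)
            \<longrightarrow> (\<forall>z\<in>ball 0 1. f z = 0))
       \<and> (\<forall>f S. open S \<and> cball 0 1 \<subseteq> S \<and> f holomorphic_on S
            \<and> (\<forall>k\<ge>2. H2_inner f (h k) = 0)
            \<longrightarrow> (\<forall>z\<in>ball 0 1. f z = 0))"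
proof (intro conjI allI impI ballI)
  fix f and z :: complex
  assume f: "f \<in> local_dirichlet_1 \<and> (\<forall>k\<ge>2. H2_inner f (h k) = 0)" and z: "z \<in> ball 0 1"
  then have "tcoeff f n = 0" for n
    using coefficients_eq_0_if_orthogonal_to_h[OF square_summable_if_local_dirichlet_1] by blast
  moreover have "f holomorphic_on ball 0 1"
    using f by (simp add: local_dirichlet_1_def H2_def)
  ultimately show "f z = 0"
    using z by (intro eq_0_if_tcoeff_eq_0[of f 1]) auto
next
  fix f S and z :: complex
  assume f: "open S \<and> cball 0 1 \<subseteq> S \<and> f holomorphic_on S \<and> (\<forall>k\<ge>2. H2_inner f (h k) = 0)"
    and z: "z \<in> ball 0 1"
  obtain e where e: "e > 0" "(\<Union>x\<in>cball 0 1. ball x e) \<subseteq> S"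
    using compact_subset_open_imp_ball_epsilon_subset[of "cball 0 1" S] f by auto
  \<comment> \<open>A disc of radius greater than 1 is needed for the power series at 0. For
    \<open>norm w > 1\<close> the point of the closed unit disc nearest to \<open>w\<close> is
    \<open>sgn w\<close>, at distance \<open>norm w - 1 < e\<close>.\<close>
  have "ball 0 (1 + e) \<subseteq> (\<Union>x\<in>cball (0::complex) 1. ball x e)"
  proof
    fix w :: complex assume w: "w \<in> ball 0 (1 + e)"
    show "w \<in> (\<Union>x\<in>cball (0::complex) 1. ball x e)"
    proof (cases "norm w \<le> 1")
      case True
      then show ?thesis using e(1) by (intro UN_I[of w]) auto
    next
      case False
      then have w0: "w \<noteq> 0" by (metis norm_zero zero_le_one)
      have "dist (sgn w) w = norm w - 1"
      proof -
        have "sgn w - w = (1 / norm w - 1) *\<^sub>R w"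
          by (simp add: sgn_div_norm algebra_simps divide_inverse)
        then have "dist (sgn w) w = \<bar>1 / norm w - 1\<bar> * norm w"
          by (simp add: dist_norm)
        also have "\<dots> = norm w - 1" using False w0 by (simp add: abs_if field_simps)
        finally show ?thesis .
      qed
      then show ?thesis using w w0 by (intro UN_I[of "sgn w"]) (auto simp: norm_sgn)
    qed
  qed
  then have hol: "f holomorphic_on ball 0 (1 + e)"
    using e(2) f by (meson holomorphic_on_subset subset_trans)
  then have "tcoeff f n = 0" for n
    using coefficients_eq_0_if_orthogonal_to_h[OF square_summable_if_holomorphic_on_larger_ball[OF hol]] e(1) f
    by simp
  then show "f z = 0"
    using hol z e(1) by (intro eq_0_if_tcoeff_eq_0[of f "1 + e"]) auto
qed

end
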